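(* Let $\kappa$ be a strongly compact cardinal and let $\mathbf{K}$ be an abstract elementary class with $\mathrm{LS}(\mathbf{K})<\kappa$. Let $\mu$ be a cardinal with $\mathrm{LS}(\mathbf{K})\le\mu<\kappa$. Then: (i) if $\mathbf{K}$ has AP on $[\mu,\kappa)$, then $\mathbf{K}$ has AP for all models of size $\ge\mu$; (ii) if $\mathbf{K}$ has JEP on $[\mu,\kappa)$, then $\mathbf{K}$ has JEP for all models of size $\ge\mu$; (iii) if $\mathbf{K}$ has DAP on $[\mu,\kappa)$, then $\mathbf{K}$ has DAP for all models of size $\ge\mu$; (iv) if $\mathbf{K}$ has DJEP on $[\mu,\kappa)$, then $\mathbf{K}$ has DJEP for all models of size $\ge\mu$.
   Context: $\mathbf{K}=(\mathbf{K},\prec_{\mathbf{K}})$ is an abstract elementary class (AEC) with strong substructure relation $\prec_{\mathbf{K}}$ and Löwenheim–Skolem number $\mathrm{LS}(\mathbf{K})$; a $\mathbf{K}$-embedding is an isomorphism onto a strong substructure. For a set $\mathcal{F}$ of cardinals, $\mathbf{K}_{\mathcal{F}}$ is the class of $M\in\mathbf{K}$ with $|M|\in\mathcal{F}$. "For all models of size $\ge\mu$" means the property holds with $\mathcal{F}=\{\lambda:\lambda\ge\mu\}$. - JEP on $\mathcal{F}$: any two models in $\mathbf{K}_{\mathcal{F}}$ can be $\mathbf{K}$-embedded into a common model of $\mathbf{K}$. - DJEP on $\mathcal{F}$: as JEP, but the two embeddings can be chosen with disjoint ranges. - AP on $\mathcal{F}$: for any $M_0\prec_{\mathbf{K}}M_1$,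 $M_0\prec_{\mathbf{K}}M_2$ with $M_0,M_1,M_2\in\mathbf{K}_{\mathcal{F}}$, there are $N\in\mathbf{K}$ and $\mathbf{K}$-embeddings $f_\ell:M_\ell\to N$ ($\ell=1,2$) agreeing on $M_0$. - DAP on $\mathcal{F}$: as AP, but additionally $f_1(M_1)\cap f_2(M_2)=f_1(M_0)$. A cardinal $\kappa$ is strongly compact iff every $\kappa$-complete filter on any set extends to a $\kappa$-complete ultrafilter. *)

theory Defs
  imports Main "HOL-Library.FuncSet"
begin

unbundle cardinal_syntax

text \<open>
  The ambient set theory: the elements of a type of class \<open>zfc\<close> are the sets of a universe
  satisfying ZFC, and the proper classes are the HOL sets over that type. The schemes of
  separation and replacement range over arbitrary HOL predicates and functions; the axiom of
  choice need not be assumed, as it follows from them and the choice operator of HOL.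
\<close>

class zfc =
  fixes elts :: "'a \<Rightarrow> 'a set"
  assumes extensionality: "elts x = elts y \<Longrightarrow> x = y"
    and foundation: "wf {(x, y). x \<in> elts y}"
    and pairing: "\<exists>z. elts z = {x, y}"
    and union: "\<exists>y. elts y = (\<Union>z\<in>elts x. elts z)"
    and powerset: "\<exists>y. elts y = {z. elts z \<subseteq> elts x}"
    and infinity: "\<exists>x. (\<exists>e\<in>elts x. elts e = {}) \<and>
                       (\<forall>y\<in>elts x. \<exists>z\<in>elts x. elts z = insert y (elts y))"
    and separation: "\<exists>y. elts y = {z \<in> elts x. P z}"
    and replacement: "\<exists>y. elts y = f ` elts x"

text \<open>A class is small if it is (the extension of) a set of the universe.\<close>

definition small :: "'v::zfc set \<Rightarrow> bool" where
  "small A \<longleftrightarrow> A \<in> range elts"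

text \<open>
  Cardinals are represented by the cardinal orders of the library whose field is a set; two of
  them denote the same cardinal iff they are related by \<open>=o\<close>. Without smallness, the order type
  of the class of all ordinals would count as a cardinal.
\<close>

definition cardinal :: "'v::zfc rel \<Rightarrow> bool" where
  "cardinal \<kappa> \<longleftrightarrow> Card_order \<kappa> \<and> small (Field \<kappa>)"

definition card_atLeastLessThan :: "'v::zfc rel \<Rightarrow> 'v rel \<Rightarrow> 'v rel set" where
  "card_atLeastLessThan \<mu> \<kappa> = {\<theta>. cardinal \<theta> \<and> \<mu> \<le>o \<theta> \<and> \<theta> <o \<kappa>}"

definition card_atLeast :: "'v::zfc rel \<Rightarrow> 'v rel set" where
  "card_atLeast \<mu> = {\<theta>. cardinal \<theta> \<and> \<mu> \<le>o \<theta>}"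


section \<open>Strongly compact cardinals\<close>

definition complete_filter :: "'v::zfc rel \<Rightarrow> 'v filter \<Rightarrow> bool" where
  "complete_filter \<kappa> F \<longleftrightarrow>
     (\<forall>\<A>::'v set set. |\<A>| <o \<kappa> \<longrightarrow> (\<forall>A\<in>\<A>. eventually (\<lambda>x. x \<in> A) F) \<longrightarrow>
        eventually (\<lambda>x. x \<in> \<Inter>\<A>) F)"

definition ultrafilter :: "'v filter \<Rightarrow> bool" where
  "ultrafilter U \<longleftrightarrow> U \<noteq> bot \<and> (\<forall>P. eventually P U \<or> eventually (\<lambda>x. \<not> P x) U)"

text \<open>
  A (proper) filter on a set \<open>I\<close> is a filter \<open>F \<noteq> bot\<close> containing \<open>I\<close>, i.e. \<open>F \<le> principal I\<close>.
  In the order of the library \<open>U \<le> F\<close> means that \<open>U\<close> contains every set in \<open>F\<close>.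
\<close>

definition strongly_compact :: "'v::zfc rel \<Rightarrow> bool" where
  "strongly_compact \<kappa> \<longleftrightarrow> cardinal \<kappa> \<and>
     (\<forall>I F. small I \<and> F \<le> principal I \<and> F \<noteq> bot \<and> complete_filter \<kappa> F \<longrightarrow>
        (\<exists>U. U \<le> F \<and> ultrafilter U \<and> complete_filter \<kappa> U))"


section \<open>Vocabularies and structures\<close>

record 'v vocabulary =
  funs :: "'v set"
  rels :: "'v set"
  fun_arity :: "'v \<Rightarrow> nat"
  rel_arity :: "'v \<Rightarrow> nat"

record 'v struct =
  univ :: "'v set"
  fun_interp :: "'v \<Rightarrow> 'v list \<Rightarrow> 'v"
  rel_interp :: "'v \<Rightarrow> 'v list set"

definition vocabulary :: "'v::zfc vocabulary \<Rightarrow> bool" where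
  "vocabulary L \<longleftrightarrow> small (funs L) \<and> small (rels L)"

definition tuples :: "'v set \<Rightarrow> nat \<Rightarrow> 'v list set" where
  "tuples A n = {xs. set xs \<subseteq> A \<and> length xs = n}"

text \<open>
  Interpretations are fixed outside their intended domains, so that two structures with the same
  universe and the same interpretations of the symbols of \<open>L\<close> are equal.
\<close>

definition is_struct :: "'v::zfc vocabulary \<Rightarrow> 'v struct \<Rightarrow> bool" where
  "is_struct L M \<longleftrightarrow> small (univ M) \<and> univ M \<noteq> {} \<and>
     (\<forall>f\<in>funs L. fun_interp M f \<in> tuples (univ M) (fun_arity L f) \<rightarrow>\<^sub>E univ M) \<and>
     (\<forall>f. f \<notin> funs L \<longrightarrow> fun_interp M f = (\<lambda>_. undefined)) \<and>
     (\<forall>R\<in>rels L. rel_interp M R \<subseteq> tuples (univ M) (rel_arity L R)) \<and>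
     (\<forall>R. R \<notin> rels L \<longrightarrow> rel_interp M R = {})"

definition substruct :: "'v::zfc vocabulary \<Rightarrow> 'v struct \<Rightarrow> 'v struct \<Rightarrow> bool" where
  "substruct L M N \<longleftrightarrow> is_struct L M \<and> is_struct L N \<and> univ M \<subseteq> univ N \<and>
     (\<forall>f\<in>funs L. \<forall>xs\<in>tuples (univ M) (fun_arity L f). fun_interp M f xs = fun_interp N f xs) \<and>
     (\<forall>R\<in>rels L. \<forall>xs\<in>tuples (univ M) (rel_arity L R).
        xs \<in> rel_interp M R \<longleftrightarrow> xs \<in> rel_interp N R)"

definition is_iso :: "'v::zfc vocabulary \<Rightarrow> ('v \<Rightarrow> 'v) \<Rightarrow> 'v struct \<Rightarrow> 'v struct \<Rightarrow> bool" where
  "is_iso L h M N \<longleftrightarrow> is_struct L M \<and> is_struct L N \<and> bij_betw h (univ M) (univ N) \<and>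
     (\<forall>f\<in>funs L. \<forall>xs\<in>tuples (univ M) (fun_arity L f).
        h (fun_interp M f xs) = fun_interp N f (map h xs)) \<and>
     (\<forall>R\<in>rels L. \<forall>xs\<in>tuples (univ M) (rel_arity L R).
        xs \<in> rel_interp M R \<longleftrightarrow> map h xs \<in> rel_interp N R)"

text \<open>\<open>N\<close> is the union of the structures \<open>M i\<close>, \<open>i \<in> I\<close>.\<close>

definition is_union ::
    "'v::zfc vocabulary \<Rightarrow> 'v set \<Rightarrow> ('v \<Rightarrow> 'v struct) \<Rightarrow> 'v struct \<Rightarrow> bool" where
  "is_union L I M N \<longleftrightarrow> univ N = (\<Union>i\<in>I. univ (M i)) \<and> (\<forall>i\<in>I. substruct L (M i) N)"


section \<open>Abstract elementary classes\<close>

text \<open>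
  Ordinals indexing chains are represented by well-orders \<open>r\<close> whose field is a set;
  \<open>underS r i\<close> is the set of indices strictly below \<open>i\<close>.
\<close>

definition limit_index :: "'v rel \<Rightarrow> 'v \<Rightarrow> bool" where
  "limit_index r i \<longleftrightarrow> i \<in> Field r \<and> underS r i \<noteq> {} \<and>
     (\<forall>j\<in>underS r i. \<exists>k\<in>underS r i. j \<in> underS r k)"

definition continuous_chain ::
    "'v::zfc vocabulary \<Rightarrow> ('v struct \<Rightarrow> 'v struct \<Rightarrow> bool) \<Rightarrow> 'v rel \<Rightarrow> ('v \<Rightarrow> 'v struct) \<Rightarrow> bool"
  where
  "continuous_chain L prec r M \<longleftrightarrow>
     Well_order r \<and> small (Field r) \<and> Field r \<noteq> {} \<and>
     (\<forall>(i, j)\<in>r. prec (M i) (M j)) \<and>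
     (\<forall>i. limit_index r i \<longrightarrow> is_union L (underS r i) M (M i))"

text \<open>
  The Lowenheim-Skolem property for \<open>\<theta>\<close>, including the usual convention that \<open>\<theta>\<close> is infinite
  and bounds the size of the vocabulary.
\<close>

definition LS_bound ::
    "'v::zfc vocabulary \<Rightarrow> 'v struct set \<Rightarrow> ('v struct \<Rightarrow> 'v struct \<Rightarrow> bool) \<Rightarrow> 'v rel \<Rightarrow> bool"
  where
  "LS_bound L K prec \<theta> \<longleftrightarrow> cardinal \<theta> \<and> natLeq \<le>o \<theta> \<and> |funs L| +c |rels L| \<le>o \<theta> \<and>
     (\<forall>M\<in>K. \<forall>A\<subseteq>univ M. \<exists>N. prec N M \<and> A \<subseteq> univ N \<and> |univ N| \<le>o |A| +c \<theta>)"

definition is_LS_number ::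
    "'v::zfc vocabulary \<Rightarrow> 'v struct set \<Rightarrow> ('v struct \<Rightarrow> 'v struct \<Rightarrow> bool) \<Rightarrow> 'v rel \<Rightarrow> bool"
  where
  "is_LS_number L K prec \<theta> \<longleftrightarrow>
     LS_bound L K prec \<theta> \<and> (\<forall>\<theta>'. LS_bound L K prec \<theta>' \<longrightarrow> \<theta> \<le>o \<theta>')"

locale AEC =
  fixes L :: "'v::zfc vocabulary"
    and K :: "'v struct set"
    and prec :: "'v struct \<Rightarrow> 'v struct \<Rightarrow> bool"  (infix \<open>\<prec>\<close> 50)
  assumes vocabulary: "vocabulary L"
    and struct: "M \<in> K \<Longrightarrow> is_struct L M"
    and iso_closed: "M \<in> K \<Longrightarrow> is_iso L h M N \<Longrightarrow> N \<in> K"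
    and prec_iso_closed: "M \<prec> N \<Longrightarrow> is_iso L h N N' \<Longrightarrow> is_iso L h M M' \<Longrightarrow> M' \<prec> N'"
    and prec_in: "M \<prec> N \<Longrightarrow> M \<in> K \<and> N \<in> K"
    and prec_substruct: "M \<prec> N \<Longrightarrow> substruct L M N"
    and prec_refl: "M \<in> K \<Longrightarrow> M \<prec> M"
    and prec_trans: "M\<^sub>0 \<prec> M\<^sub>1 \<Longrightarrow> M\<^sub>1 \<prec> M\<^sub>2 \<Longrightarrow> M\<^sub>0 \<prec> M\<^sub>2"
    and coherence: "M\<^sub>0 \<prec> M\<^sub>2 \<Longrightarrow> M\<^sub>1 \<prec> M\<^sub>2 \<Longrightarrow> substruct L M\<^sub>0 M\<^sub>1 \<Longrightarrow> M\<^sub>0 \<prec> M\<^sub>1"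
    and chain_in: "continuous_chain L prec r C \<Longrightarrow> is_union L (Field r) C N \<Longrightarrow> N \<in> K"
    and chain_upper: "continuous_chain L prec r C \<Longrightarrow> is_union L (Field r) C N \<Longrightarrow>
          i \<in> Field r \<Longrightarrow> C i \<prec> N"
    and chain_smooth: "continuous_chain L prec r C \<Longrightarrow> is_union L (Field r) C N \<Longrightarrow>
          (\<And>i. i \<in> Field r \<Longrightarrow> C i \<prec> N') \<Longrightarrow> N \<prec> N'"
    and Lowenheim_Skolem: "\<exists>\<theta>. LS_bound L K prec \<theta>"

definition K_embedding ::
    "'v::zfc vocabulary \<Rightarrow> ('v struct \<Rightarrow> 'v struct \<Rightarrow> bool) \<Rightarrow>
     ('v \<Rightarrow> 'v) \<Rightarrow> 'v struct \<Rightarrow> 'v struct \<Rightarrow> bool" where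
  "K_embedding L prec f M N \<longleftrightarrow> (\<exists>N'. prec N' N \<and> is_iso L f M N')"


section \<open>Joint embedding and amalgamation\<close>

definition models_on :: "'v::zfc struct set \<Rightarrow> 'v rel set \<Rightarrow> 'v struct set" where
  "models_on K F = {M \<in> K. \<exists>\<theta>\<in>F. |univ M| =o \<theta>}"

definition JEP_on ::
    "'v::zfc vocabulary \<Rightarrow> 'v struct set \<Rightarrow> ('v struct \<Rightarrow> 'v struct \<Rightarrow> bool) \<Rightarrow> 'v rel set \<Rightarrow> bool"
  where
  "JEP_on L K prec F \<longleftrightarrow>
     (\<forall>M\<^sub>1\<in>models_on K F. \<forall>M\<^sub>2\<in>models_on K F. \<exists>N\<in>K. \<exists>f\<^sub>1 f\<^sub>2.
        K_embedding L prec f\<^sub>1 M\<^sub>1 N \<and> K_embedding L prec f\<^sub>2 M\<^sub>2 N)"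

definition DJEP_on ::
    "'v::zfc vocabulary \<Rightarrow> 'v struct set \<Rightarrow> ('v struct \<Rightarrow> 'v struct \<Rightarrow> bool) \<Rightarrow> 'v rel set \<Rightarrow> bool"
  where
  "DJEP_on L K prec F \<longleftrightarrow>
     (\<forall>M\<^sub>1\<in>models_on K F. \<forall>M\<^sub>2\<in>models_on K F. \<exists>N\<in>K. \<exists>f\<^sub>1 f\<^sub>2.
        K_embedding L prec f\<^sub>1 M\<^sub>1 N \<and> K_embedding L prec f\<^sub>2 M\<^sub>2 N \<and>
        f\<^sub>1 ` univ M\<^sub>1 \<inter> f\<^sub>2 ` univ M\<^sub>2 = {})"

definition AP_on ::
    "'v::zfc vocabulary \<Rightarrow> 'v struct set \<Rightarrow> ('v struct \<Rightarrow> 'v struct \<Rightarrow> bool) \<Rightarrow> 'v rel set \<Rightarrow> bool"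
  where
  "AP_on L K prec F \<longleftrightarrow>
     (\<forall>M\<^sub>0\<in>models_on K F. \<forall>M\<^sub>1\<in>models_on K F. \<forall>M\<^sub>2\<in>models_on K F.
        prec M\<^sub>0 M\<^sub>1 \<and> prec M\<^sub>0 M\<^sub>2 \<longrightarrow>
        (\<exists>N\<in>K. \<exists>f\<^sub>1 f\<^sub>2. K_embedding L prec f\<^sub>1 M\<^sub>1 N \<and> K_embedding L prec f\<^sub>2 M\<^sub>2 N \<and>
           (\<forall>x\<in>univ M\<^sub>0. f\<^sub>1 x = f\<^sub>2 x)))"

definition DAP_on ::
    "'v::zfc vocabulary \<Rightarrow> 'v struct set \<Rightarrow> ('v struct \<Rightarrow> 'v struct \<Rightarrow> bool) \<Rightarrow> 'v rel set \<Rightarrow> bool"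
  where
  "DAP_on L K prec F \<longleftrightarrow>
     (\<forall>M\<^sub>0\<in>models_on K F. \<forall>M\<^sub>1\<in>models_on K F. \<forall>M\<^sub>2\<in>models_on K F.
        prec M\<^sub>0 M\<^sub>1 \<and> prec M\<^sub>0 M\<^sub>2 \<longrightarrow>
        (\<exists>N\<in>K. \<exists>f\<^sub>1 f\<^sub>2. K_embedding L prec f\<^sub>1 M\<^sub>1 N \<and> K_embedding L prec f\<^sub>2 M\<^sub>2 N \<and>
           (\<forall>x\<in>univ M\<^sub>0. f\<^sub>1 x = f\<^sub>2 x) \<and>
           f\<^sub>1 ` univ M\<^sub>1 \<inter> f\<^sub>2 ` univ M\<^sub>2 = f\<^sub>1 ` univ M\<^sub>0))"

end

theory Submission
  imports Defs
begin

text \<open>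
  Given large models, take a fine \<open>\<kappa>\<close>-complete ultrafilter on the set of their parts of size less
  than \<open>\<kappa>\<close>, amalgamate small strong submodels containing each part, and pass to the ultraproduct
  of the amalgams. The ultraproduct belongs to the class without appeal to the presentation theorem:
  by \<open>\<kappa>\<close>-completeness every set of at most \<open>\<mu>\<close> of its elements is contained in a substructure
  isomorphic to a strong submodel of almost every factor; coherence makes these substructures a
  system directed under \<open>\<prec>\<close>, and an abstract elementary class is closed under directed unions.
  Smoothness for directed unions likewise turns the limit maps into strong embeddings.
\<close>

section \<open>Sets of the universe\<close>

text \<open>The definition of strong compactness speaks only of extending filters. Regularity of
  \<kappa> has to be extracted from it, since it is what makes the filter generated by the cones
  \<open>{i. Y \<subseteq> elts i}\<close> \<kappa>-complete. The size \<mu> is the scale of all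
  local arguments: the Lowenheim-Skolem property holds there, there are at most \<mu> symbols, and
  \<mu> is below \<kappa>. So at most \<mu> atomic facts describe a part of size \<mu>, and one
  large set of coordinates settles them all; this does the work of the theorem of Los. Likewise a
  choice among at most \<mu> alternatives that varies with the coordinate becomes constant on a
  large set. The axioms of the class mention chains only, so directed unions have to be reduced to
  chains. Moreover filters, chains and structures all live over the type \<open>'v\<close>. Index
  sets, points of the product and members of directed systems are therefore coded as elements of
  \<open>'v\<close>, with smallness checked each time.\<close>

definition set_of :: "'v::zfc set \<Rightarrow> 'v" where
  "set_of A = (SOME v. elts v = A)"

lemma elts_set_of: "small A \<Longrightarrow> elts (set_of A) = A"
  unfolding small_def set_of_def by (metis (mono_tags) imageE someI_ex)

lemma small_elts: "small (elts v)"
  by (simp add: small_def)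

lemma small_subset:
  assumes "small B" "A \<subseteq> B"
  shows "small A"
proof -
  obtain x where x: "elts x = B" using assms(1) by (auto simp: small_def)
  obtain y where "elts y = {z \<in> elts x. z \<in> A}" using separation[of x "\<lambda>z. z \<in> A"] by blast
  then have "elts y = A" using x assms(2) by auto
  then show ?thesis by (auto simp: small_def)
qed

lemma small_image:
  fixes f :: "'v::zfc \<Rightarrow> 'v"
  assumes "small A"
  shows "small (f ` A)"
proof -
  obtain x where x: "elts x = A" using assms by (auto simp: small_def)
  obtain y where "elts y = f ` elts x" using replacement[of f x] by blast
  then show ?thesis using x by (auto simp: small_def)
qed

lemma small_doubleton: "small {x, y}"
  unfolding small_def using pairing[of x y] by (metis rangeI)

lemma small_UN:
  fixes A :: "'v::zfc \<Rightarrow> 'v set"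
  assumes "small I" "\<And>i. i \<in> I \<Longrightarrow> small (A i)"
  shows "small (\<Union>i\<in>I. A i)"
proof -
  obtain x where x: "elts x = (\<lambda>i. set_of (A i)) ` I"
    using small_image[OF assms(1), of "\<lambda>i. set_of (A i)"] unfolding small_def by (metis imageE)
  obtain y where "elts y = (\<Union>z\<in>elts x. elts z)" using union[of x] by blast
  then have "elts y = (\<Union>i\<in>I. A i)" using x assms(2) by (auto simp: elts_set_of)
  then show ?thesis by (auto simp: small_def)
qed

lemma small_Un:
  assumes "small A" "small B"
  shows "small (A \<union> B)"
proof -
  have "small (\<Union>v\<in>{set_of A, set_of B}. elts v)"
    by (intro small_UN small_doubleton small_elts)
  then show ?thesis using assms by (simp add: elts_set_of)
qed

lemma small_subsets:
  assumes "small A"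
  shows "small {v. elts v \<subseteq> A}"
proof -
  obtain x where "elts x = A" using assms by (auto simp: small_def)
  then show ?thesis unfolding small_def using powerset[of x] by (metis rangeI)
qed

section \<open>Pairs and functions as elements of the universe\<close>

definition kpair :: "'v::zfc \<Rightarrow> 'v \<Rightarrow> 'v" where
  "kpair x y = set_of {set_of {x, x}, set_of {x, y}}"

lemma kpair_eq_iff: "kpair x y = kpair x' y' \<longleftrightarrow> x = x' \<and> y = y'"
proof -
  have s: "set_of {a, b} = set_of {c, d} \<longleftrightarrow> {a, b} = {c, d}" for a b c d :: 'a
    using elts_set_of[OF small_doubleton] by metis
  show ?thesis
    unfolding kpair_def s doubleton_eq_iff by auto
qed

text \<open>The points of an ultraproduct must again lie in \<open>'v\<close>; the graph serves as
  the code of a section.\<close>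

definition fun_code :: "'v::zfc set \<Rightarrow> ('v \<Rightarrow> 'v) \<Rightarrow> 'v" where
  "fun_code I g = set_of ((\<lambda>i. kpair i (g i)) ` I)"

lemma fun_code_eqD:
  assumes "small I" "fun_code I g = fun_code I h" "i \<in> I"
  shows "g i = h i"
proof -
  have "(\<lambda>i. kpair i (g i)) ` I = (\<lambda>i. kpair i (h i)) ` I"
    using assms(2) elts_set_of[OF small_image[OF assms(1)]] unfolding fun_code_def by metis
  then have "kpair i (g i) \<in> (\<lambda>i. kpair i (h i)) ` I" using assms(3) by blast
  then show ?thesis by (auto simp: kpair_eq_iff)
qed

text \<open>A Kuratowski pair over \<open>I \<union> B\<close> lies in the double power set of
  \<open>I \<union> B\<close>, hence the graph of a function lies in the triple one.\<close>

lemma small_fun_codes: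
  assumes "small I" "small B"
  shows "small (fun_code I ` (I \<rightarrow> B))"
proof (rule small_subset)
  show "small {v. elts v \<subseteq> {w. elts w \<subseteq> {u. elts u \<subseteq> I \<union> B}}}"
    by (intro small_subsets small_Un assms)
  have d: "set_of {x, y} \<in> {u. elts u \<subseteq> D}" if "x \<in> D" "y \<in> D" for x y :: 'a and D
    using that by (auto simp: elts_set_of[OF small_doubleton])
  have "kpair x y \<in> {w. elts w \<subseteq> {u. elts u \<subseteq> I \<union> B}}" if "x \<in> I" "y \<in> B" for x y
    unfolding kpair_def by (intro d) (use that in auto)
  then have "(\<lambda>i. kpair i (g i)) ` I \<subseteq> {w. elts w \<subseteq> {u. elts u \<subseteq> I \<union> B}}"
    if "g \<in> I \<rightarrow> B" for g
    using that by blast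
  then have "elts (fun_code I g) \<subseteq> {w. elts w \<subseteq> {u. elts u \<subseteq> I \<union> B}}"
    if "g \<in> I \<rightarrow> B" for g
    unfolding fun_code_def elts_set_of[OF small_image[OF assms(1)]] using that by simp
  then show "fun_code I ` (I \<rightarrow> B) \<subseteq> {v. elts v \<subseteq> {w. elts w \<subseteq> {u. elts u \<subseteq> I \<union> B}}}"
    by (simp add: image_subset_iff)
qed

text \<open>
  Every class of the reduced product is represented by a chosen section \<open>dec x\<close>, so that the
  interpretations below can be computed coordinatewise without quotients.
\<close>

lemma reduced_product_carrier:
  fixes A :: "'v::zfc \<Rightarrow> 'v set"
  assumes I: "small I" and A: "\<And>i. i \<in> I \<Longrightarrow> small (A i)" "\<And>i. i \<in> I \<Longrightarrow> A i \<noteq> {}"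
    and U: "U \<le> principal I"
  obtains P :: "'v set" and dec cls where "small P"
    "\<And>x i. x \<in> P \<Longrightarrow> i \<in> I \<Longrightarrow> dec x i \<in> A i"
    "\<And>x y. x \<in> P \<Longrightarrow> y \<in> P \<Longrightarrow> \<forall>\<^sub>F i in U. dec x i = dec y i \<Longrightarrow> x = y"
    "\<And>g. \<forall>\<^sub>F i in U. g i \<in> A i \<Longrightarrow> cls g \<in> P"
    "\<And>g. \<forall>\<^sub>F i in U. g i \<in> A i \<Longrightarrow> \<forall>\<^sub>F i in U. dec (cls g) i = g i"
proof -
  define G where "G = {g. \<forall>\<^sub>F i in U. g i \<in> A i}"
  define rep where "rep g = (SOME h. h \<in> Pi I A \<and> (\<forall>\<^sub>F i in U. h i = g i))" for g
  define cls where "cls g = fun_code I (rep g)" for g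
  define dec where "dec x = (SOME h. h \<in> Pi I A \<and> fun_code I h = x)" for x
  have evI: "\<forall>\<^sub>F i in U. i \<in> I" using U by (simp add: le_principal)
  have rep: "rep g \<in> Pi I A \<and> (\<forall>\<^sub>F i in U. rep g i = g i)" if "g \<in> G" for g
    unfolding rep_def
  proof (rule someI_ex[where P = "\<lambda>h. h \<in> Pi I A \<and> (\<forall>\<^sub>F i in U. h i = g i)"], intro exI conjI)
    \<comment> \<open>Where \<open>g\<close> leaves \<open>A i\<close>, an arbitrary point is
      substituted: decoded sections must take values in \<open>A i\<close> at every \<open>i\<close>
      of \<open>I\<close>, not only almost everywhere.\<close>
    let ?h = "\<lambda>i. if g i \<in> A i then g i else SOME a. a \<in> A i"
    show "?h \<in> Pi I A" using A(2) by (auto simp: some_in_eq)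
    show "\<forall>\<^sub>F i in U. ?h i = g i"
      using that unfolding G_def mem_Collect_eq by (rule eventually_mono) simp
  qed
  have dec: "dec (cls g) \<in> Pi I A \<and> fun_code I (dec (cls g)) = cls g" if "g \<in> G" for g
    unfolding dec_def
    by (rule someI_ex[where P = "\<lambda>h. h \<in> Pi I A \<and> fun_code I h = cls g"])
      (use rep[OF that] in \<open>auto simp: cls_def\<close>)
  have dec_cls: "\<forall>\<^sub>F i in U. dec (cls g) i = g i" if "g \<in> G" for g
  proof -
    have "dec (cls g) i = rep g i" if "i \<in> I" for i
      using fun_code_eqD[OF I _ that] dec[OF \<open>g \<in> G\<close>] by (metis cls_def)
    moreover have "\<forall>\<^sub>F i in U. rep g i = g i" using rep[OF that] by blast
    with evI show ?thesis by eventually_elim (simp add: calculation)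
  qed
  show thesis
  proof (rule that[of "cls ` G" dec cls])
    show "small (cls ` G)"
    proof (rule small_subset)
      show "small (fun_code I ` (I \<rightarrow> (\<Union>i\<in>I. A i)))"
        by (intro small_fun_codes small_UN I A)
      show "cls ` G \<subseteq> fun_code I ` (I \<rightarrow> (\<Union>i\<in>I. A i))"
      proof
        fix x assume "x \<in> cls ` G"
        then obtain g where g: "g \<in> G" "x = fun_code I (rep g)" by (auto simp: cls_def)
        then have "rep g \<in> I \<rightarrow> (\<Union>i\<in>I. A i)" using rep by blast
        then show "x \<in> fun_code I ` (I \<rightarrow> (\<Union>i\<in>I. A i))" using g(2) by blast
      qed
    qed
    show "dec x i \<in> A i" if "x \<in> cls ` G" "i \<in> I" for x i
      using that dec by auto
    show "x = y" if xy: "x \<in> cls ` G" "y \<in> cls ` G" and ev: "\<forall>\<^sub>F i in U. dec x i = dec y i" for x y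
    proof -
      obtain g h where g: "g \<in> G" "x = cls g" and h: "h \<in> G" "y = cls h" using xy by blast
      have gh: "\<forall>\<^sub>F i in U. g i = h i"
        using dec_cls[OF g(1)] dec_cls[OF h(1)] ev unfolding g(2) h(2) by eventually_elim simp
      \<comment> \<open>The choice in \<open>rep\<close> sees \<open>g\<close> only through the
        functions almost everywhere equal to it. Equivalent \<open>g\<close> and \<open>h\<close>
        pose the same choice problem, so they receive the same representative.\<close>
      have "(\<forall>\<^sub>F i in U. k i = g i) = (\<forall>\<^sub>F i in U. k i = h i)" for k
      proof
        show "\<forall>\<^sub>F i in U. k i = h i" if "\<forall>\<^sub>F i in U. k i = g i"
          using gh that by eventually_elim simp
        show "\<forall>\<^sub>F i in U. k i = g i" if "\<forall>\<^sub>F i in U. k i = h i"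
          using gh that by eventually_elim simp
      qed
      then have "rep g = rep h" unfolding rep_def by simp
      then show ?thesis using g h by (simp add: cls_def)
    qed
  qed (use dec_cls in \<open>auto simp: G_def\<close>)
qed

section \<open>Cardinal arithmetic\<close>

lemma ordLeq_Field: "Card_order r \<Longrightarrow> |A| \<le>o r \<longleftrightarrow> |A| \<le>o |Field r|"
  using card_of_Field_ordIso ordIso_symmetric ordLeq_ordIso_trans by blast

lemma card_of_tuples:
  assumes "Cinfinite r" "|A| \<le>o r"
  shows "|tuples A n| \<le>o r"
proof (induction n)
  case 0
  have "tuples A 0 = {[]}" by (auto simp: tuples_def)
  then show ?case
    using assms(1) by (metis Card_order_singl_ordLeq cinfinite_def finite.emptyI)
next
  case (Suc n)
  have "tuples A (Suc n) \<subseteq> case_prod (#) ` (A \<times> tuples A n)"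
    by (force simp: tuples_def length_Suc_conv)
  moreover have "|A \<times> tuples A n| \<le>o r"
    using assms Suc by (auto simp: cinfinite_def intro: card_of_Times_ordLeq_infinite_Field)
  ultimately show ?case
    by (meson card_of_image card_of_mono1 ordLeq_transitive)
qed

lemma card_of_lists:
  assumes "Cinfinite r" "|A| \<le>o r"
  shows "|lists A| \<le>o r"
proof -
  have "lists A = (\<Union>n. tuples A n)" by (auto simp: tuples_def)
  moreover have "|UNIV :: nat set| \<le>o r"
    using natLeq_ordLeq_cinfinite[OF assms(1)] card_of_nat ordIso_ordLeq_trans by blast
  ultimately show ?thesis using card_of_tuples[OF assms] assms(1) by (simp add: UNION_Cinfinite_bound)
qed

lemma card_of_Fpow:
  assumes "Cinfinite r" "|A| \<le>o r"
  shows "|Fpow A| \<le>o r"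
proof -
  have "Fpow A \<subseteq> set ` lists A"
    by (auto simp: Fpow_def) (metis finite_list image_eqI in_listsI subset_code(1))
  then show ?thesis
    using card_of_lists[OF assms] by (meson card_of_image card_of_mono1 ordLeq_transitive)
qed

lemma Cinfinite_of_natLeq:
  assumes "natLeq \<le>o r" "Card_order r"
  shows "Cinfinite r"
  using assms cinfinite_mono natLeq_cinfinite by blast

section \<open>Strongly compact cardinals\<close>

lemma complete_filter_ball:
  assumes "complete_filter \<kappa> F" "|Z| <o \<kappa>" "\<And>z. z \<in> Z \<Longrightarrow> \<forall>\<^sub>F x in F. P z x"
  shows "\<forall>\<^sub>F x in F. \<forall>z\<in>Z. P z x"
proof -
  let ?A = "(\<lambda>z. {x. P z x}) ` Z"
  have "|?A| <o \<kappa>" using card_of_image assms(2) ordLeq_ordLess_trans by blast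
  then have "\<forall>\<^sub>F x in F. x \<in> \<Inter>?A"
    using assms(1,3) unfolding complete_filter_def by auto
  then show ?thesis by simp
qed

text \<open>If each of fewer than \<kappa> alternatives failed on a large set, all would fail on a
  common one. This turns a witness chosen separately in each coordinate into a fixed one.\<close>

lemma complete_ultrafilter_bex:
  assumes "complete_filter \<kappa> U" "ultrafilter U" "|Z| <o \<kappa>" "\<forall>\<^sub>F x in U. \<exists>z\<in>Z. P z x"
  shows "\<exists>z\<in>Z. \<forall>\<^sub>F x in U. P z x"
proof (rule ccontr)
  assume "\<not> ?thesis"
  then have "\<forall>\<^sub>F x in U. \<not> P z x" if "z \<in> Z" for z
    using that assms(2) unfolding ultrafilter_def by blast
  then have "\<forall>\<^sub>F x in U. \<forall>z\<in>Z. \<not> P z x"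
    by (rule complete_filter_ball[OF assms(1,3)])
  with assms(4) have "\<forall>\<^sub>F x in U. False" by eventually_elim auto
  then show False using assms(2) by (simp add: ultrafilter_def eventually_False)
qed

text \<open>
  If \<open>\<kappa>\<close> were singular, a \<open>\<kappa>\<close>-complete ultrafilter would be closed under intersections of length
  \<open>\<kappa>\<close>; one on the power set of \<open>\<kappa>\<close> containing all sets with complement of size at most \<open>\<kappa>\<close> would
  then decide membership of all elements of \<open>\<kappa>\<close> simultaneously, hence concentrate on a point.
\<close>

lemma strongly_compact_regular:
  fixes \<kappa> :: "'v::zfc rel"
  assumes sc: "strongly_compact \<kappa>" and inf: "Cinfinite \<kappa>"
  shows "regularCard \<kappa>"
  unfolding regularCard_def
proof (intro allI impI, elim conjE, rule ccontr)
  fix C assume C: "C \<subseteq> Field \<kappa>" "cofinal C \<kappa>" and ne: "\<not> |C| =o \<kappa>"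
  have co: "Card_order \<kappa>" and sm: "small (Field \<kappa>)"
    using sc by (auto simp: strongly_compact_def cardinal_def)
  have "|C| \<le>o \<kappa>" using C(1) co by (meson card_of_Field_ordIso card_of_mono1 ordLeq_ordIso_trans)
  then have C\<kappa>: "|C| <o \<kappa>" using ne ordLeq_iff_ordLess_or_ordIso by blast
  define I where "I = {v. elts v \<subseteq> Field \<kappa>}"
  \<comment> \<open>The null sets are those of size at most \<kappa>. They are closed under unions
    of \<kappa> many, so completeness of \<open>F\<close> does not presuppose the regularity to be
    proved.\<close>
  define F where "F = Abs_filter (\<lambda>P. |{v \<in> I. \<not> P v}| \<le>o \<kappa>)"
  have Fev: "eventually P F \<longleftrightarrow> |{v \<in> I. \<not> P v}| \<le>o \<kappa>" for P
    unfolding F_def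
  proof (rule eventually_Abs_filter, rule is_filter.intro)
    show "|{v \<in> I. \<not> True}| \<le>o \<kappa>" using co by (simp add: Card_order_empty)
    fix P Q
    show "|{v \<in> I. \<not> (P v \<and> Q v)}| \<le>o \<kappa>"
      if "|{v \<in> I. \<not> P v}| \<le>o \<kappa>" "|{v \<in> I. \<not> Q v}| \<le>o \<kappa>"
    proof -
      have "{v \<in> I. \<not> (P v \<and> Q v)} = {v \<in> I. \<not> P v} \<union> {v \<in> I. \<not> Q v}" by auto
      then show ?thesis using that inf by (simp add: Un_Cinfinite_bound)
    qed
    show "|{v \<in> I. \<not> Q v}| \<le>o \<kappa>" if "\<forall>x. P x \<longrightarrow> Q x" "|{v \<in> I. \<not> P v}| \<le>o \<kappa>"
    proof -
      have "{v \<in> I. \<not> Q v} \<subseteq> {v \<in> I. \<not> P v}" using that(1) by auto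
      then show ?thesis using that(2) by (meson card_of_mono1 ordLeq_transitive)
    qed
  qed
  have "small I" unfolding I_def by (rule small_subsets[OF sm])
  moreover have "F \<le> principal I"
    using co by (simp add: le_principal Fev Card_order_empty)
  \<comment> \<open>Properness is Cantor's theorem, since \<open>elts\<close> maps \<open>I\<close>
    onto the power set of \<open>Field \<kappa>\<close>.\<close>
  moreover have "F \<noteq> bot"
  proof
    assume "F = bot"
    then have "|I| \<le>o \<kappa>" using Fev[of "\<lambda>_. False"] by simp
    moreover have "elts ` I = Pow (Field \<kappa>)"
    proof
      show "Pow (Field \<kappa>) \<subseteq> elts ` I"
      proof
        fix X assume X: "X \<in> Pow (Field \<kappa>)"
        then have "elts (set_of X) = X" using elts_set_of small_subset[OF sm] by blast
        then show "X \<in> elts ` I" using X unfolding I_def by (metis PowD image_eqI mem_Collect_eq)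
      qed
    qed (auto simp: I_def)
    ultimately have "|Pow (Field \<kappa>)| \<le>o \<kappa>" by (metis card_of_image ordLeq_transitive)
    then show False using Card_order_Pow[OF co] not_ordLess_ordLeq by blast
  qed
  moreover have "complete_filter \<kappa> F"
    unfolding complete_filter_def
  proof (intro allI impI)
    fix \<A> :: "'v set set"
    assume \<A>: "|\<A>| <o \<kappa>" "\<forall>A\<in>\<A>. \<forall>\<^sub>F x in F. x \<in> A"
    have "{v \<in> I. v \<notin> \<Inter>\<A>} = (\<Union>A\<in>\<A>. {v \<in> I. v \<notin> A})" by auto
    then show "\<forall>\<^sub>F x in F. x \<in> \<Inter>\<A>"
      using \<A> inf unfolding Fev by (simp add: UNION_Cinfinite_bound ordLess_imp_ordLeq)
  qed
  ultimately obtain U where U: "U \<le> F" "ultrafilter U" "complete_filter \<kappa> U"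
    using sc unfolding strongly_compact_def by blast
  \<comment> \<open>The candidate for the point of concentration: the ultrafilter decides each
    \<open>\<xi>\<close> separately, and \<open>B\<close> collects the positive answers.\<close>
  define B where "B = {\<xi> \<in> Field \<kappa>. \<forall>\<^sub>F v in U. \<xi> \<in> elts v}"
  have dec: "\<forall>\<^sub>F v in U. \<xi> \<in> elts v \<longleftrightarrow> \<xi> \<in> B" if "\<xi> \<in> Field \<kappa>" for \<xi>
    using that U(2) unfolding B_def ultrafilter_def by (cases "\<forall>\<^sub>F v in U. \<xi> \<in> elts v") auto
  \<comment> \<open>The cofinal set \<open>C\<close> splits the \<kappa> many decisions into fewer
    than \<kappa> blocks, each of size less than \<kappa>. Completeness is applied inside every
    block and then across the blocks.\<close>
  have "\<forall>\<^sub>F v in U. \<forall>c\<in>C. \<forall>\<xi>\<in>underS \<kappa> c. \<xi> \<in> elts v \<longleftrightarrow> \<xi> \<in> B"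
  proof (rule complete_filter_ball[OF U(3) C\<kappa>], rule complete_filter_ball[OF U(3)])
    fix c assume "c \<in> C"
    then show "|underS \<kappa> c| <o \<kappa>" using card_of_underS[OF co] C(1) by blast
  next
    fix c \<xi> assume "\<xi> \<in> underS \<kappa> c"
    then show "\<forall>\<^sub>F v in U. \<xi> \<in> elts v \<longleftrightarrow> \<xi> \<in> B" by (intro dec) (auto simp: underS_def Field_def)
  qed
  moreover have "\<exists>c\<in>C. \<xi> \<in> underS \<kappa> c" if "\<xi> \<in> Field \<kappa>" for \<xi>
    using C(2) that unfolding cofinal_def underS_def by blast
  ultimately have "\<forall>\<^sub>F v in U. \<forall>\<xi>\<in>Field \<kappa>. \<xi> \<in> elts v \<longleftrightarrow> \<xi> \<in> B"
    by (auto elim!: eventually_mono)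
  moreover have "\<forall>\<^sub>F v in U. v \<in> I"
    using U(1) \<open>F \<le> principal I\<close> by (simp add: le_principal filter_leD)
  \<comment> \<open>A single point is null, so \<open>F\<close> excludes it, whereas the decisions
    above make almost every \<open>v\<close> equal to the code of \<open>B\<close>.\<close>
  moreover have "\<forall>\<^sub>F v in U. v \<noteq> set_of B"
  proof (rule filter_leD[OF U(1)])
    have "{v \<in> I. \<not> v \<noteq> set_of B} \<subseteq> {set_of B}" by auto
    moreover have "|{set_of B}| \<le>o \<kappa>"
      using inf by (metis Card_order_singl_ordLeq cinfinite_def finite.emptyI)
    ultimately show "\<forall>\<^sub>F v in F. v \<noteq> set_of B"
      unfolding Fev by (meson card_of_mono1 ordLeq_transitive)
  qed
  ultimately have "\<forall>\<^sub>F v in U. False"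
  proof eventually_elim
    case (elim v)
    have B: "B \<subseteq> Field \<kappa>" by (auto simp: B_def)
    then have "elts v = B" using elim(1,2) unfolding I_def by blast
    then have "v = set_of B"
      using elts_set_of[OF small_subset[OF sm B]] extensionality by metis
    then show ?case using elim(3) by simp
  qed
  then show False using U(2) by (simp add: ultrafilter_def eventually_False)
qed

text \<open>The set usually written P_\<kappa>(A), coded inside \<open>'v\<close> because strong
  compactness is about filters over that type.\<close>

definition small_parts :: "'v::zfc rel \<Rightarrow> 'v set \<Rightarrow> 'v set" where
  "small_parts \<kappa> A = {v. elts v \<subseteq> A \<and> |elts v| <o \<kappa>}"

lemma small_small_parts: "small A \<Longrightarrow> small (small_parts \<kappa> A)"
  by (rule small_subset[OF small_subsets]) (auto simp: small_parts_def)

text \<open>The cones over small parts generate a filter, and any ultrafilter extending it is fine.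
  An intersection of fewer than \<kappa> cones contains the cone over the union of their bases;
  regularity keeps that union of size less than \<kappa>.\<close>

lemma fine_ultrafilter:
  fixes \<kappa> :: "'v::zfc rel"
  assumes sc: "strongly_compact \<kappa>" and inf: "Cinfinite \<kappa>" and A: "small A"
  obtains U where "U \<le> principal (small_parts \<kappa> A)" "ultrafilter U" "complete_filter \<kappa> U"
    "\<And>Y. Y \<subseteq> A \<Longrightarrow> |Y| <o \<kappa> \<Longrightarrow> \<forall>\<^sub>F i in U. Y \<subseteq> elts i"
proof -
  let ?I = "small_parts \<kappa> A"
  let ?p = "\<lambda>P. \<exists>Y\<subseteq>A. |Y| <o \<kappa> \<and> (\<forall>i\<in>?I. Y \<subseteq> elts i \<longrightarrow> P i)"
  define F where "F = Abs_filter ?p"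
  have empty: "|{}::'v set| <o \<kappa>"
    using inf by (auto simp: cinfinite_def Field_card_of card_order_on_well_order_on
        intro!: finite_ordLess_infinite card_of_Well_order)
  have Fev: "eventually P F \<longleftrightarrow> ?p P" for P
    unfolding F_def
  proof (rule eventually_Abs_filter, rule is_filter.intro)
    show "?p (\<lambda>_. True)" using empty by blast
    show "?p (\<lambda>x. P x \<and> Q x)" if pq: "?p P" "?p Q" for P Q
    proof -
      obtain Y where "Y \<subseteq> A" "|Y| <o \<kappa>" "\<forall>i\<in>?I. Y \<subseteq> elts i \<longrightarrow> P i"
        using pq(1) by blast
      moreover obtain Z where "Z \<subseteq> A" "|Z| <o \<kappa>" "\<forall>i\<in>?I. Z \<subseteq> elts i \<longrightarrow> Q i"
        using pq(2) by blast
      moreover from calculation have "|Y \<union> Z| <o \<kappa>" using inf Un_Cinfinite_bound_strict by blast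
      ultimately show ?thesis by (intro exI[of _ "Y \<union> Z"]) simp
    qed
    show "?p Q" if pq: "\<forall>x. P x \<longrightarrow> Q x" "?p P" for P Q
    proof -
      obtain Y where "Y \<subseteq> A" "|Y| <o \<kappa>" "\<forall>i\<in>?I. Y \<subseteq> elts i \<longrightarrow> P i"
        using pq(2) by blast
      with pq(1) show ?thesis by (intro exI[of _ Y]) simp
    qed
  qed
  have F: "F \<le> principal ?I" using empty by (auto simp: le_principal Fev)
  moreover have "F \<noteq> bot"
  proof
    assume "F = bot"
    then have "?p (\<lambda>_. False)" using Fev[of "\<lambda>_. False"] by simp
    then obtain Y where Y: "Y \<subseteq> A" "|Y| <o \<kappa>" "\<forall>i\<in>?I. \<not> Y \<subseteq> elts i" by blast
    \<comment> \<open>The cone over \<open>Y\<close> contains the code of \<open>Y\<close> itself,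
      so no generating set is empty.\<close>
    have "elts (set_of Y) = Y" by (rule elts_set_of[OF small_subset[OF A Y(1)]])
    with Y show False by (metis (mono_tags) mem_Collect_eq order_refl small_parts_def)
  qed
  moreover have "complete_filter \<kappa> F"
    unfolding complete_filter_def
  proof (intro allI impI)
    fix \<A> :: "'v set set"
    assume \<A>: "|\<A>| <o \<kappa>" "\<forall>B\<in>\<A>. \<forall>\<^sub>F x in F. x \<in> B"
    then obtain Y where Y: "\<And>B. B \<in> \<A> \<Longrightarrow> Y B \<subseteq> A \<and> |Y B| <o \<kappa> \<and> (\<forall>i\<in>?I. Y B \<subseteq> elts i \<longrightarrow> i \<in> B)"
      unfolding Fev by metis
    have "|\<Union>B\<in>\<A>. Y B| <o \<kappa>"
      using card_of_UNION_ordLess_infinite_Field_regularCard[OF strongly_compact_regular[OF sc inf] inf \<A>(1)]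
        Y by blast
    then show "\<forall>\<^sub>F x in F. x \<in> \<Inter>\<A>"
      unfolding Fev
    proof (intro exI[of _ "\<Union>B\<in>\<A>. Y B"] conjI ballI impI)
      show "(\<Union>B\<in>\<A>. Y B) \<subseteq> A" using Y by blast
      show "i \<in> \<Inter>\<A>" if "i \<in> ?I" "(\<Union>B\<in>\<A>. Y B) \<subseteq> elts i" for i
      proof
        fix B assume B: "B \<in> \<A>"
        then have "Y B \<subseteq> elts i" using that(2) by blast
        then show "i \<in> B" using Y[OF B] that(1) by blast
      qed
    qed
  qed
  ultimately obtain U where U: "U \<le> F" "ultrafilter U" "complete_filter \<kappa> U"
    using sc small_small_parts[OF A] unfolding strongly_compact_def by metis
  show thesis
  proof (rule that)
    show "U \<le> principal ?I" using U(1) F by (rule order_trans)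
    show "\<forall>\<^sub>F i in U. Y \<subseteq> elts i" if "Y \<subseteq> A" "|Y| <o \<kappa>" for Y
    proof (rule filter_leD[OF U(1)])
      show "\<forall>\<^sub>F i in F. Y \<subseteq> elts i"
        unfolding Fev by (intro exI[of _ Y] conjI that ballI impI)
    qed
  qed (rule U)+
qed

section \<open>Substructures and isomorphisms\<close>

text \<open>Outside the tuples over \<open>A\<close> the values are reset to the defaults demanded
  by \<open>is_struct\<close>. A substructure is then recovered from its universe alone, and systems
  of substructures can be indexed by subsets.\<close>

definition restrict_struct :: "'v::zfc vocabulary \<Rightarrow> 'v struct \<Rightarrow> 'v set \<Rightarrow> 'v struct" where
  "restrict_struct L P A =
     \<lparr>univ = A,
      fun_interp = (\<lambda>f. if f \<in> funs L then restrict (fun_interp P f) (tuples A (fun_arity L f))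
                        else (\<lambda>_. undefined)),
      rel_interp = (\<lambda>R. if R \<in> rels L then rel_interp P R \<inter> tuples A (rel_arity L R) else {})\<rparr>"

lemma univ_restrict_struct [simp]: "univ (restrict_struct L P A) = A"
  by (simp add: restrict_struct_def)

lemma tuples_mono: "A \<subseteq> B \<Longrightarrow> xs \<in> tuples A n \<Longrightarrow> xs \<in> tuples B n"
  by (auto simp: tuples_def)

lemma map_in_tuples: "h ` A \<subseteq> B \<Longrightarrow> xs \<in> tuples A n \<Longrightarrow> map h xs \<in> tuples B n"
  by (auto simp: tuples_def)

lemma fun_interp_closed:
  assumes "is_struct L M" "f \<in> funs L" "xs \<in> tuples (univ M) (fun_arity L f)"
  shows "fun_interp M f xs \<in> univ M"
  using assms unfolding is_struct_def by blast

lemma substruct_restrict_struct: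
  assumes P: "is_struct L P" and A: "A \<subseteq> univ P" "A \<noteq> {}"
    and cl: "\<And>f xs. f \<in> funs L \<Longrightarrow> xs \<in> tuples A (fun_arity L f) \<Longrightarrow> fun_interp P f xs \<in> A"
  shows "substruct L (restrict_struct L P A) P"
proof -
  have "is_struct L (restrict_struct L P A)"
    using A P cl small_subset[of "univ P" A]
    by (auto simp: is_struct_def restrict_struct_def restrict_def)
  then show ?thesis
    using P A by (auto simp: substruct_def restrict_struct_def)
qed

lemma substruct_closed:
  assumes "substruct L (restrict_struct L P A) P" "f \<in> funs L" "xs \<in> tuples A (fun_arity L f)"
  shows "fun_interp P f xs \<in> A"
  using assms fun_interp_closed[of L "restrict_struct L P A" f xs]
  by (auto simp: substruct_def restrict_struct_def)

lemma substruct_restrict_mono: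
  assumes "substruct L (restrict_struct L P A) P" "substruct L (restrict_struct L P B) P" "A \<subseteq> B"
  shows "substruct L (restrict_struct L P A) (restrict_struct L P B)"
  using assms tuples_mono[OF assms(3)] by (auto simp: substruct_def restrict_struct_def)

lemma restrict_struct_univ:
  assumes "substruct L M P"
  shows "restrict_struct L P (univ M) = M"
proof (rule struct.equality)
  have M: "is_struct L M" using assms by (simp add: substruct_def)
  show "fun_interp (restrict_struct L P (univ M)) = fun_interp M"
  proof
    fix f
    show "fun_interp (restrict_struct L P (univ M)) f = fun_interp M f"
    proof (cases "f \<in> funs L")
      case True
      have "fun_interp M f \<in> extensional (tuples (univ M) (fun_arity L f))"
        using True M by (auto simp: is_struct_def PiE_def)
      then show ?thesis
        using True assms by (auto simp: restrict_struct_def substruct_def extensional_def)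
    qed (use M in \<open>auto simp: restrict_struct_def is_struct_def\<close>)
  qed
  show "rel_interp (restrict_struct L P (univ M)) = rel_interp M"
  proof
    fix R
    show "rel_interp (restrict_struct L P (univ M)) R = rel_interp M R"
    proof (cases "R \<in> rels L")
      case True
      then have "rel_interp M R \<subseteq> tuples (univ M) (rel_arity L R)"
        using M by (simp add: is_struct_def)
      then show ?thesis using True assms unfolding substruct_def restrict_struct_def by auto
    qed (use M in \<open>auto simp: restrict_struct_def is_struct_def\<close>)
  qed
qed auto

lemma is_iso_restrict:
  assumes h: "is_iso L h N N'" and MN: "substruct L M N"
  shows "is_iso L h M (restrict_struct L N' (h ` univ M))"
    and "substruct L (restrict_struct L N' (h ` univ M)) N'"
proof -
  have M: "is_struct L M" and sub: "univ M \<subseteq> univ N" using MN by (auto simp: substruct_def)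
  have bij: "bij_betw h (univ N) (univ N')" and N': "is_struct L N'"
    using h by (auto simp: is_iso_def)
  have lift: "\<exists>ys\<in>tuples (univ M) n. xs = map h ys" if "xs \<in> tuples (h ` univ M) n" for xs n
  proof -
    have "xs \<in> map h ` lists (univ M)" using that lists_image[of h "univ M"] by (auto simp: tuples_def)
    then show ?thesis using that by (auto simp: tuples_def)
  qed
  show sN': "substruct L (restrict_struct L N' (h ` univ M)) N'"
  proof (rule substruct_restrict_struct[OF N'])
    show "h ` univ M \<subseteq> univ N'" using sub bij by (auto simp: bij_betw_def)
    show "h ` univ M \<noteq> {}" using M by (auto simp: is_struct_def)
    fix f xs assume f: "f \<in> funs L" and "xs \<in> tuples (h ` univ M) (fun_arity L f)"
    then obtain ys where ys: "ys \<in> tuples (univ M) (fun_arity L f)" "xs = map h ys"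
      using lift by blast
    then have "fun_interp N' f xs = h (fun_interp M f ys)"
      using h MN f tuples_mono[OF sub ys(1)] by (auto simp: is_iso_def substruct_def)
    then show "fun_interp N' f xs \<in> h ` univ M" using fun_interp_closed[OF M f ys(1)] by simp
  qed
  have up: "map h xs \<in> tuples (h ` univ M) n" "xs \<in> tuples (univ N) n"
    if "xs \<in> tuples (univ M) n" for xs n
    using map_in_tuples[OF subset_refl that] tuples_mono[OF sub that] by auto
  show "is_iso L h M (restrict_struct L N' (h ` univ M))"
    unfolding is_iso_def
  proof (intro conjI ballI M)
    show "is_struct L (restrict_struct L N' (h ` univ M))" using sN' by (simp add: substruct_def)
    show "bij_betw h (univ M) (univ (restrict_struct L N' (h ` univ M)))"
      using bij sub by (auto simp: bij_betw_def inj_on_subset)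
    show "h (fun_interp M f xs) = fun_interp (restrict_struct L N' (h ` univ M)) f (map h xs)"
      if "f \<in> funs L" "xs \<in> tuples (univ M) (fun_arity L f)" for f xs
      using that up[OF that(2)] h MN by (simp add: is_iso_def substruct_def restrict_struct_def)
    show "xs \<in> rel_interp M R \<longleftrightarrow> map h xs \<in> rel_interp (restrict_struct L N' (h ` univ M)) R"
      if "R \<in> rels L" "xs \<in> tuples (univ M) (rel_arity L R)" for R xs
      using that up[OF that(2)] h MN by (simp add: is_iso_def substruct_def restrict_struct_def)
  qed
qed

lemma is_iso_substruct_image:
  assumes "is_iso L h M N" "substruct L N N'"
  shows "N = restrict_struct L N' (h ` univ M)"
  using restrict_struct_univ[OF assms(2)] assms(1) by (simp add: is_iso_def bij_betw_def)

lemma is_iso_inverse: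
  assumes h: "is_iso L h M N" and g: "\<And>x. x \<in> univ M \<Longrightarrow> g (h x) = x"
  shows "is_iso L g N M"
proof -
  have bij: "bij_betw h (univ M) (univ N)" and M: "is_struct L M" and N: "is_struct L N"
    using h by (auto simp: is_iso_def)
  have gy: "g y \<in> univ M" "h (g y) = y" if "y \<in> univ N" for y
    using that bij_betw_imp_surj_on[OF bij] g by (metis imageE)+
  have "bij_betw g (univ N) (univ M)"
    by (rule bij_betw_byWitness[where f' = h]) (use bij gy g in \<open>auto simp: bij_betw_def\<close>)
  moreover have tup: "map g ys \<in> tuples (univ M) n \<and> map h (map g ys) = ys"
    if "ys \<in> tuples (univ N) n" for ys n
    using that gy by (auto simp: tuples_def intro!: map_idI)
  moreover have "g (fun_interp N f ys) = fun_interp M f (map g ys)"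
    if "f \<in> funs L" "ys \<in> tuples (univ N) (fun_arity L f)" for f ys
  proof -
    have "h (fun_interp M f (map g ys)) = fun_interp N f ys"
      using h that tup[OF that(2)] by (simp add: is_iso_def del: map_map)
    then show ?thesis using g fun_interp_closed[OF M that(1)] tup[OF that(2)] by metis
  qed
  moreover have "ys \<in> rel_interp N R \<longleftrightarrow> map g ys \<in> rel_interp M R"
    if "R \<in> rels L" "ys \<in> tuples (univ N) (rel_arity L R)" for R ys
    using h that tup[OF that(2)] by (simp add: is_iso_def del: map_map)
  ultimately show ?thesis using M N by (auto simp: is_iso_def)
qed

text \<open>Since \<open>d\<close> is injective, every clause about \<open>F\<close> can be tested
  after applying \<open>d\<close>, where it becomes a clause about \<open>f\<close>. Here
  \<open>d\<close> will be the projection to a coordinate and \<open>f\<close> a coordinate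
  embedding.\<close>

lemma is_iso_cancel_left:
  assumes d: "is_iso L d Q N" and f: "is_iso L f M N"
    and F: "F ` univ M \<subseteq> univ Q" "\<And>x. x \<in> univ M \<Longrightarrow> d (F x) = f x"
  shows "is_iso L F M Q"
proof -
  have Q: "is_struct L Q" and M: "is_struct L M" using d f by (auto simp: is_iso_def)
  have inj: "inj_on d (univ Q)" and im: "d ` univ Q = univ N" "f ` univ M = univ N" "inj_on f (univ M)"
    using d f by (auto simp: is_iso_def bij_betw_def)
  have "inj_on F (univ M)" using im(3) F(2) by (auto simp: inj_on_def) metis
  moreover have "univ Q \<subseteq> F ` univ M"
  proof
    fix y assume y: "y \<in> univ Q"
    then obtain x where x: "x \<in> univ M" "d y = f x" using im by (metis imageE imageI)
    have "y = F x" by (rule inj_onD[OF inj]) (use x y F in auto)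
    then show "y \<in> F ` univ M" using x by simp
  qed
  ultimately have "bij_betw F (univ M) (univ Q)" using F(1) by (auto simp: bij_betw_def)
  moreover have up: "map F xs \<in> tuples (univ Q) n" "map d (map F xs) = map f xs"
    if "xs \<in> tuples (univ M) n" for xs n
    using that F by (auto simp: tuples_def)
  moreover have "F (fun_interp M g xs) = fun_interp Q g (map F xs)"
    if g: "g \<in> funs L" and xs: "xs \<in> tuples (univ M) (fun_arity L g)" for g xs
  proof -
    have "d (F (fun_interp M g xs)) = d (fun_interp Q g (map F xs))"
      using d f g xs up[OF xs] F(2) fun_interp_closed[OF M g xs] by (simp add: is_iso_def del: map_map)
    moreover have "F (fun_interp M g xs) \<in> univ Q" using F(1) fun_interp_closed[OF M g xs] by blast
    ultimately show ?thesis
      using inj_onD[OF inj] fun_interp_closed[OF Q g up(1)[OF xs]] by blast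
  qed
  moreover have "xs \<in> rel_interp M R \<longleftrightarrow> map F xs \<in> rel_interp Q R"
    if "R \<in> rels L" "xs \<in> tuples (univ M) (rel_arity L R)" for R xs
    using d f that up[OF that(2)] by (simp add: is_iso_def del: map_map)
  ultimately show ?thesis using M Q by (auto simp: is_iso_def)
qed

section \<open>Directed unions in abstract elementary classes\<close>

lemma directed_finite_bound:
  assumes "D \<noteq> {}" "\<forall>u\<in>D. \<forall>v\<in>D. \<exists>w\<in>D. elts u \<union> elts v \<subseteq> elts w"
    and "finite F" "F \<subseteq> D"
  shows "\<exists>w\<in>D. \<forall>u\<in>F. elts u \<subseteq> elts w"
  using assms(3,4)
proof (induction F)
  case empty
  then show ?case using assms(1) by blast
next
  case (insert u F)
  then obtain w where "w \<in> D" "\<forall>u\<in>F. elts u \<subseteq> elts w" by blast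
  moreover then obtain w' where "w' \<in> D" "elts u \<union> elts w \<subseteq> elts w'"
    using assms(2) insert.prems by (metis insert_subset)
  ultimately show ?case by (intro bexI[of _ w']) auto
qed

text \<open>Arities are finite, so all entries of a tuple over the union lie in one member, and that
  member is closed under the functions.\<close>

lemma directed_union_closed:
  assumes P: "is_struct L P" and ne: "D \<noteq> {}"
    and sub: "\<forall>v\<in>D. substruct L (restrict_struct L P (elts v)) P"
    and dir: "\<forall>u\<in>D. \<forall>v\<in>D. \<exists>w\<in>D. elts u \<union> elts v \<subseteq> elts w"
  shows "substruct L (restrict_struct L P (\<Union>v\<in>D. elts v)) P"
proof (rule substruct_restrict_struct[OF P])
  have v: "elts v \<subseteq> univ P" "elts v \<noteq> {}" if "v \<in> D" for v
    using bspec[OF sub that] by (simp_all add: substruct_def is_struct_def)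
  then show "(\<Union>v\<in>D. elts v) \<subseteq> univ P" by blast
  show "(\<Union>v\<in>D. elts v) \<noteq> {}" using ne v(2) by simp
  fix f xs assume f: "f \<in> funs L" and xs: "xs \<in> tuples (\<Union>v\<in>D. elts v) (fun_arity L f)"
  then have "\<forall>x\<in>set xs. \<exists>v. v \<in> D \<and> x \<in> elts v" by (auto simp: tuples_def)
  then obtain s where s: "\<forall>x\<in>set xs. s x \<in> D \<and> x \<in> elts (s x)" by metis
  then obtain w where w: "w \<in> D" "\<forall>u\<in>s ` set xs. elts u \<subseteq> elts w"
    using directed_finite_bound[OF ne dir, of "s ` set xs"] by (auto simp: image_subset_iff)
  then have "xs \<in> tuples (elts w) (fun_arity L f)" using s xs by (auto simp: tuples_def)
  then show "fun_interp P f xs \<in> (\<Union>v\<in>D. elts v)"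
    using substruct_closed[OF bspec[OF sub w(1)] f] w(1) by blast
qed

text \<open>Recursion along strict inclusion of finite sets: \<open>ub F\<close> is taken above the
  members of \<open>F\<close> and above the finitely many earlier values \<open>ub G\<close> with
  \<open>G \<subset> F\<close>. An unrestricted choice of bounds would not be monotone, and its
  image of \<open>Fpow X\<close> could fail to be directed.\<close>

lemma monotone_finite_bounds:
  assumes "D \<noteq> {}" "\<forall>u\<in>D. \<forall>v\<in>D. \<exists>w\<in>D. elts u \<union> elts v \<subseteq> elts w"
  obtains ub where "\<And>F. F \<in> Fpow D \<Longrightarrow> ub F \<in> D"
    "\<And>F u. F \<in> Fpow D \<Longrightarrow> u \<in> F \<Longrightarrow> elts u \<subseteq> elts (ub F)"
    "\<And>F G. F \<in> Fpow D \<Longrightarrow> G \<subseteq> F \<Longrightarrow> elts (ub G) \<subseteq> elts (ub F)"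
proof -
  let ?P = "\<lambda>f F r. F \<in> Fpow D \<longrightarrow>
    r \<in> D \<and> (\<forall>u\<in>F. elts u \<subseteq> elts r) \<and> (\<forall>G. G \<subset> F \<longrightarrow> elts (f G) \<subseteq> elts r)"
  have "\<exists>f. \<forall>F. ?P f F (f F)"
  proof (rule dependent_wf_choice[OF wf_finite_psubset])
    fix f g :: "'a set \<Rightarrow> 'a" and F r
    assume "\<And>G. (G, F) \<in> finite_psubset \<Longrightarrow> f G = g G"
    then show "?P f F r = ?P g F r" by (auto simp: Fpow_def finite_psubset_def)
  next
    fix F f assume IH: "\<And>G. (G, F) \<in> finite_psubset \<Longrightarrow> ?P f G (f G)"
    show "\<exists>r. ?P f F r"
    proof (cases "F \<in> Fpow D")
      case True
      let ?H = "F \<union> f ` {G. G \<subset> F}"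
      have "finite {G. G \<subset> F}"
        using True by (auto simp: Fpow_def intro: finite_subset[of _ "Pow F"])
      then have "finite ?H" using True by (auto simp: Fpow_def)
      moreover have "?H \<subseteq> D" 
      proof -
        have "f G \<in> D" if "G \<subset> F" for G
        proof -
          have "(G, F) \<in> finite_psubset" "G \<in> Fpow D"
            using that True by (auto simp: Fpow_def finite_psubset_def intro: finite_subset)
          then show ?thesis using IH by blast
        qed
        then show ?thesis using True by (auto simp: Fpow_def)
      qed
      ultimately have "\<exists>w\<in>D. \<forall>u\<in>?H. elts u \<subseteq> elts w"
        by (rule directed_finite_bound[OF assms])
      then obtain w where "w \<in> D" "\<forall>u\<in>?H. elts u \<subseteq> elts w" by (rule bexE)
      then show ?thesis by (intro exI[of _ w]) simp
    qed simp
  qed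
  then obtain ub where ub: "\<And>F. ?P ub F (ub F)" by blast
  show thesis
  proof (rule that[of ub])
    show "elts (ub G) \<subseteq> elts (ub F)" if "F \<in> Fpow D" "G \<subseteq> F" for F G
      using ub[of F] that by (cases "G = F") auto
  qed (use ub in blast)+
qed

text \<open>The predecessors of a limit index are linearly ordered without a last element.
  Continuity of a chain whose stages are built from finite subsets of initial segments rests on
  this.\<close>

lemma limit_index_finite_bound:
  assumes r: "Well_order r" and lim: "limit_index r i" and F: "finite F" "F \<subseteq> underS r i"
  shows "\<exists>j\<in>underS r i. F \<subseteq> underS r j"
  using F
proof (induction F)
  case empty
  then show ?case using lim by (auto simp: limit_index_def)
next
  case (insert x F)
  then obtain j where j: "j \<in> underS r i" "F \<subseteq> underS r j" by blast
  obtain k where k: "k \<in> underS r i" "x \<in> underS r k"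
    using lim insert.prems by (auto simp: limit_index_def)
  have wo: "wo_rel r" using r by (simp add: wo_rel_def)
  have jk: "j \<in> Field r" "k \<in> Field r" using j k by (auto simp: underS_def Field_def)
  then consider "(j, k) \<in> r" | "(k, j) \<in> r" using wo_rel.TOTALS[OF wo] by blast
  then show ?case
  proof cases
    case 1
    then have "underS r j \<subseteq> underS r k"
      by (intro underS_incr wo_rel.TRANS wo_rel.ANTISYM wo)
    then show ?thesis using j k by blast
  next
    case 2
    then have "underS r k \<subseteq> underS r j"
      by (intro underS_incr wo_rel.TRANS wo_rel.ANTISYM wo)
    then show ?thesis using j k by blast
  qed
qed

context AEC
begin

declare prec_trans [trans]

text \<open>
  Induction on the cardinality of the system. An infinite system \<open>D\<close> is exhausted by the systems
  \<open>ub ` Fpow X\<close> for proper initial segments \<open>X\<close> of a well-ordering of \<open>D\<close>; monotonicity of \<open>ub\<close>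
  makes them directed, and they stay finite when \<open>X\<close> is finite.
\<close>

lemma directed_union:
  assumes P: "is_struct L P" and "D \<subseteq> {v. elts v \<subseteq> univ P}" "D \<noteq> {}"
    and "\<forall>u\<in>D. \<forall>v\<in>D. elts u \<subseteq> elts v \<longrightarrow>
      restrict_struct L P (elts u) \<prec> restrict_struct L P (elts v)"
    and "\<forall>u\<in>D. \<forall>v\<in>D. \<exists>w\<in>D. elts u \<union> elts v \<subseteq> elts w"
    and "\<forall>v\<in>D. substruct L (restrict_struct L P (elts v)) P"
  shows "restrict_struct L P (\<Union>v\<in>D. elts v) \<in> K \<and>
    (\<forall>v\<in>D. restrict_struct L P (elts v) \<prec> restrict_struct L P (\<Union>v\<in>D. elts v)) \<and>
    (\<forall>N. (\<forall>v\<in>D. restrict_struct L P (elts v) \<prec> N) \<longrightarrow> restrict_struct L P (\<Union>v\<in>D. elts v) \<prec> N)"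
  using assms(2-)
proof (induction "|D|" arbitrary: D rule: wf_induct_rule[OF wf_ordLess])
  case (1 D)
  note sub = 1(2) and ne = 1(3) and mono = 1(4) and dir = 1(5) and subst = 1(6)
  let ?R = "restrict_struct L P"
  show ?case
  proof (cases "finite D")
    case True
    then obtain w where w: "w \<in> D" "\<forall>u\<in>D. elts u \<subseteq> elts w"
      using directed_finite_bound[OF ne dir] by blast
    then have "(\<Union>v\<in>D. elts v) = elts w" by blast
    moreover have "?R (elts w) \<in> K" using mono w(1) prec_in by blast
    ultimately show ?thesis using w mono by simp
  next
    case inf: False
    obtain ub where ub: "\<And>F. F \<in> Fpow D \<Longrightarrow> ub F \<in> D"
      "\<And>F u. F \<in> Fpow D \<Longrightarrow> u \<in> F \<Longrightarrow> elts u \<subseteq> elts (ub F)"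
      "\<And>F G. F \<in> Fpow D \<Longrightarrow> G \<subseteq> F \<Longrightarrow> elts (ub G) \<subseteq> elts (ub F)"
      using monotone_finite_bounds[OF ne dir] by blast
    \<comment> \<open>For \<open>X \<subseteq> D\<close>, two elements \<open>ub F\<close> and
      \<open>ub G\<close> of \<open>E X\<close> are bounded by \<open>ub (F \<union> G)\<close>,
      which is again in \<open>E X\<close>. Even \<open>E {}\<close> is nonempty, namely
      \<open>{ub {}}\<close>, so the chain below has a first stage.\<close>
    define E where "E X = ub ` Fpow X" for X
    define S where "S X = (\<Union>v\<in>E X. elts v)" for X
    have ED: "E X \<subseteq> D" if "X \<subseteq> D" for X
      using ub(1) Fpow_mono[OF that] by (auto simp: E_def)
    have Emono: "E X \<subseteq> E Y" if "X \<subseteq> Y" for X Y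
      using Fpow_mono[OF that] by (auto simp: E_def)
    have Ecard: "|E X| <o |D|" if "|X| <o |D|" for X
    proof (cases "finite X")
      case True
      then have "finite (E X)" by (auto simp: E_def Fpow_def intro!: finite_imageI)
      then show ?thesis
        using inf by (intro finite_ordLess_infinite card_of_Well_order) (auto simp: Field_card_of)
    next
      case False
      then have "|Fpow X| \<le>o |X|"
        by (intro card_of_Fpow ordLeq_refl card_of_Card_order conjI)
          (simp add: cinfinite_def Field_card_of)
      then have "|E X| \<le>o |X|" unfolding E_def using card_of_image ordLeq_transitive by blast
      then show ?thesis using that ordLeq_ordLess_trans by blast
    qed
    have IH: "?R (S X) \<in> K" "\<And>v. v \<in> E X \<Longrightarrow> ?R (elts v) \<prec> ?R (S X)"
      "\<And>N. (\<And>v. v \<in> E X \<Longrightarrow> ?R (elts v) \<prec> N) \<Longrightarrow> ?R (S X) \<prec> N"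
      if X: "X \<subseteq> D" "|X| <o |D|" for X
    proof -
      have dirE: "\<forall>u\<in>E X. \<forall>v\<in>E X. \<exists>w\<in>E X. elts u \<union> elts v \<subseteq> elts w"
      proof (intro ballI)
        fix u v assume "u \<in> E X" "v \<in> E X"
        obtain F G where FG: "F \<in> Fpow X" "u = ub F" "G \<in> Fpow X" "v = ub G"
          using \<open>u \<in> E X\<close> \<open>v \<in> E X\<close> by (auto simp: E_def)
        then have FGX: "F \<union> G \<in> Fpow X" by (auto simp: Fpow_def)
        then have "F \<union> G \<in> Fpow D" using Fpow_mono[OF X(1)] by blast
        then have "elts u \<union> elts v \<subseteq> elts (ub (F \<union> G))"
          using ub(3)[of "F \<union> G"] FG by simp
        then show "\<exists>w\<in>E X. elts u \<union> elts v \<subseteq> elts w" using FGX by (auto simp: E_def)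
      qed
      have "?R (S X) \<in> K \<and> (\<forall>v\<in>E X. ?R (elts v) \<prec> ?R (S X)) \<and>
          (\<forall>N. (\<forall>v\<in>E X. ?R (elts v) \<prec> N) \<longrightarrow> ?R (S X) \<prec> N)"
        unfolding S_def
      proof (rule 1(1)[OF Ecard[OF X(2)]])
        show "E X \<noteq> {}" by (auto simp: E_def Fpow_def)
        show "E X \<subseteq> {v. elts v \<subseteq> univ P}" using ED[OF X(1)] sub by blast
        show "\<forall>u\<in>E X. \<forall>v\<in>E X. elts u \<subseteq> elts v \<longrightarrow> ?R (elts u) \<prec> ?R (elts v)"
          using ED[OF X(1)] mono by (meson subsetD)
        show "\<forall>v\<in>E X. substruct L (?R (elts v)) P" using ED[OF X(1)] subst by blast
      qed (rule dirE)
      then show "?R (S X) \<in> K" "\<And>v. v \<in> E X \<Longrightarrow> ?R (elts v) \<prec> ?R (S X)"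
        "\<And>N. (\<And>v. v \<in> E X \<Longrightarrow> ?R (elts v) \<prec> N) \<Longrightarrow> ?R (S X) \<prec> N" by blast+
    qed
    \<comment> \<open>Because \<open>|D|\<close> is a cardinal order, each proper initial segment is
      smaller than \<open>D\<close>, and the induction hypothesis covers every stage. Because it is
      infinite it has no last index, so each element of \<open>D\<close> occurs in some
      segment.\<close>
    define C where "C i = ?R (S (underS |D| i))" for i
    have wo: "Well_order |D|" and fld: "Field |D| = D" by (rule card_of_Well_order, rule Field_card_of)
    have wr: "wo_rel |D|" using wo unfolding wo_rel_def .
    have uD: "underS |D| i \<subseteq> D" for i using fld by (auto simp: underS_def Field_def)
    have uc: "|underS |D| i| <o |D|" if "i \<in> D" for i
      by (rule card_of_underS[OF card_of_Card_order]) (simp add: that fld)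
    have uincr: "underS |D| i \<subseteq> underS |D| j" if "(i, j) \<in> |D|" for i j
      by (intro underS_incr wo_rel.TRANS wo_rel.ANTISYM wr that)
    have uex: "\<exists>w\<in>D. v \<in> underS |D| w" if "v \<in> D" for v
      using infinite_Card_order_limit[OF card_of_Card_order, of D v] inf that
      by (auto simp: fld underS_def)
    have Cmono: "C i \<prec> C j" if "(i, j) \<in> |D|" for i j
    proof -
      have ij: "i \<in> D" "j \<in> D" using that fld by (auto simp: Field_def)
      show ?thesis unfolding C_def
        by (intro IH(3)[OF uD uc[OF ij(1)]] IH(2)[OF uD uc[OF ij(2)]])
          (use Emono[OF uincr[OF that]] in blast)
    qed
    have chain: "continuous_chain L (\<prec>) |D| C"
      unfolding continuous_chain_def
    proof (intro conjI allI impI)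
      show "small (Field |D| )" unfolding fld
        by (rule small_subset[OF small_subsets sub]) (use P in \<open>simp add: is_struct_def\<close>)
      show "Field |D| \<noteq> {}" using ne fld by simp
      show "\<forall>(i, j)\<in>|D|. C i \<prec> C j" using Cmono by auto
      fix i assume lim: "limit_index |D| i"
      \<comment> \<open>A point enters a stage through the bound of a finite set of indices; below a
        limit this finite set already lies below an earlier index.\<close>
      have "S (underS |D| i) \<subseteq> (\<Union>j\<in>underS |D| i. S (underS |D| j))"
      proof
        fix x assume "x \<in> S (underS |D| i)"
        then obtain F where F: "F \<in> Fpow (underS |D| i)" "x \<in> elts (ub F)" by (auto simp: S_def E_def)
        then obtain j where "j \<in> underS |D| i" "F \<subseteq> underS |D| j"
          using limit_index_finite_bound[OF wo lim, of F] by (auto simp: Fpow_def)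
        then show "x \<in> (\<Union>j\<in>underS |D| i. S (underS |D| j))"
          using F by (auto simp: S_def E_def Fpow_def)
      qed
      moreover have "S (underS |D| j) \<subseteq> S (underS |D| i)" if "j \<in> underS |D| i" for j
        using Emono[OF uincr, of j i] that by (auto simp: S_def underS_def)
      ultimately show "is_union L (underS |D| i) C (C i)"
        unfolding is_union_def using Cmono prec_substruct by (auto simp: C_def underS_def)
    qed (rule wo)
    have union: "is_union L (Field |D| ) C (?R (\<Union>v\<in>D. elts v))"
      unfolding is_union_def fld
    proof (intro conjI ballI)
      have "(\<Union>v\<in>D. elts v) \<subseteq> (\<Union>i\<in>D. S (underS |D| i))"
      proof
        fix x assume "x \<in> (\<Union>v\<in>D. elts v)"
        then obtain v w where v: "v \<in> D" "x \<in> elts v" and w: "w \<in> D" "v \<in> underS |D| w"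
          using uex by blast
        then have "x \<in> elts (ub {v})" using ub(2)[of "{v}" v] by (auto simp: Fpow_def)
        then have "x \<in> S (underS |D| w)" using w by (auto simp: S_def E_def Fpow_def)
        then show "x \<in> (\<Union>i\<in>D. S (underS |D| i))" using w by blast
      qed
      then show "univ (?R (\<Union>v\<in>D. elts v)) = (\<Union>i\<in>D. univ (C i))"
        using ED[OF uD] by (fastforce simp: C_def S_def)
      fix i assume i: "i \<in> D"
      have Ei: "E (underS |D| i) \<noteq> {}" "E (underS |D| i) \<subseteq> D"
        using ED[OF uD] by (auto simp: E_def Fpow_def)
      \<comment> \<open>The induction hypothesis puts \<open>C i\<close> into \<open>K\<close>, so
        it is a structure; closure of its universe under the functions of \<open>P\<close> is read
        off from this.\<close>
      have "is_struct L (C i)" using IH(1)[OF uD uc[OF i]] struct by (simp add: C_def)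
      moreover have cl: "fun_interp P f xs \<in> S (underS |D| i)"
        if "f \<in> funs L" "xs \<in> tuples (S (underS |D| i)) (fun_arity L f)" for f xs
        using fun_interp_closed[OF \<open>is_struct L (C i)\<close>, of f xs] that
        by (simp add: C_def restrict_struct_def)
      moreover have "S (underS |D| i) \<subseteq> univ P" using Ei sub by (auto simp: S_def)
      moreover have "S (underS |D| i) \<noteq> {}" using \<open>is_struct L (C i)\<close> by (auto simp: C_def is_struct_def)
      ultimately have "substruct L (C i) P"
        unfolding C_def by (intro substruct_restrict_struct[OF P]) auto
      then show "substruct L (C i) (?R (\<Union>v\<in>D. elts v))"
        unfolding C_def
        by (rule substruct_restrict_mono[OF _ directed_union_closed[OF P ne subst dir]])
          (use Ei in \<open>auto simp: S_def\<close>)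
    qed
    show ?thesis
    proof (intro conjI ballI allI impI)
      show "?R (\<Union>v\<in>D. elts v) \<in> K" by (rule chain_in[OF chain union])
      show "?R (elts v) \<prec> ?R (\<Union>v\<in>D. elts v)" if v: "v \<in> D" for v
      proof -
        obtain w where w: "w \<in> D" "v \<in> underS |D| w" using uex[OF v] by blast
        have v1: "{v} \<in> Fpow D" "{v} \<in> Fpow (underS |D| w)" using v w by (auto simp: Fpow_def)
        \<comment> \<open>\<open>v\<close> itself need not belong to any of the sets
          \<open>E X\<close>; it is reached through \<open>ub {v}\<close>.\<close>
        have "?R (elts v) \<prec> ?R (elts (ub {v}))" using mono v ub(1)[OF v1(1)] ub(2)[OF v1(1)] by blast
        also have "\<dots> \<prec> C w" unfolding C_def
          by (rule IH(2)[OF uD uc[OF w(1)]]) (use v1 in \<open>auto simp: E_def\<close>)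
        also have "\<dots> \<prec> ?R (\<Union>v\<in>D. elts v)" by (rule chain_upper[OF chain union]) (simp add: fld w)
        finally show ?thesis .
      qed
      show "?R (\<Union>v\<in>D. elts v) \<prec> N" if N: "\<forall>v\<in>D. ?R (elts v) \<prec> N" for N
      proof (rule chain_smooth[OF chain union])
        fix i assume "i \<in> Field |D|"
        then show "C i \<prec> N" unfolding C_def
          by (intro IH(3)[OF uD uc]) (use N ED[OF uD] in \<open>auto simp: fld\<close>)
      qed
    qed
  qed
qed

end

section \<open>Ultraproducts\<close>

lemma substruct_refl: "is_struct L M \<Longrightarrow> substruct L M M"
  by (simp add: substruct_def)

lemma (in AEC) LS_boundE:
  assumes "LS_bound L K (\<prec>) \<mu>" "M \<in> K" "A \<subseteq> univ M" "|A| \<le>o \<mu>"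
  obtains B where "B \<prec> M" "A \<subseteq> univ B" "|univ B| \<le>o \<mu>"
proof -
  have \<mu>: "Card_order \<mu>" "Cinfinite \<mu>"
    using assms(1) Cinfinite_of_natLeq by (auto simp: LS_bound_def cardinal_def)
  obtain B where B: "B \<prec> M" "A \<subseteq> univ B" "|univ B| \<le>o |A| +c \<mu>"
    using assms(1,2,3) unfolding LS_bound_def by blast
  have "|A| +c \<mu> \<le>o \<mu>"
    by (intro csum_cinfinite_bound assms(4) ordLeq_refl \<mu> card_of_Card_order)
  then show thesis using that B ordLeq_transitive by blast
qed

text \<open>The carrier is known only through its decoding and class maps, so the coding of sections
  inside the universe can be forgotten from here on.\<close>

locale complete_ultraproduct = AEC L K prec
  for L :: "'v::zfc vocabulary" and K and prec (infix \<open>\<prec>\<close> 50) +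
  fixes \<kappa> \<mu> :: "'v rel" and I :: "'v set" and U :: "'v filter" and N :: "'v \<Rightarrow> 'v struct"
    and P :: "'v set" and dec :: "'v \<Rightarrow> 'v \<Rightarrow> 'v" and cls :: "('v \<Rightarrow> 'v) \<Rightarrow> 'v"
  assumes LS: "LS_bound L K (\<prec>) \<mu>" and \<mu>\<kappa>: "\<mu> <o \<kappa>"
    and U: "U \<le> principal I" "ultrafilter U" "complete_filter \<kappa> U"
    and N: "i \<in> I \<Longrightarrow> N i \<in> K"
    and small_P: "small P"
    and dec_in: "x \<in> P \<Longrightarrow> i \<in> I \<Longrightarrow> dec x i \<in> univ (N i)"
    and dec_inj: "x \<in> P \<Longrightarrow> y \<in> P \<Longrightarrow> \<forall>\<^sub>F i in U. dec x i = dec y i \<Longrightarrow> x = y"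
    and cls_in: "\<forall>\<^sub>F i in U. g i \<in> univ (N i) \<Longrightarrow> cls g \<in> P"
    and dec_cls: "\<forall>\<^sub>F i in U. g i \<in> univ (N i) \<Longrightarrow> \<forall>\<^sub>F i in U. dec (cls g) i = g i"
begin

section \<open>The ultraproduct and its good parts\<close>

definition ult :: "'v struct" where
  "ult =
     \<lparr>univ = P,
      fun_interp = (\<lambda>f. if f \<in> funs L
        then restrict (\<lambda>xs. cls (\<lambda>i. fun_interp (N i) f (map (\<lambda>x. dec x i) xs))) (tuples P (fun_arity L f))
        else (\<lambda>_. undefined)),
      rel_interp = (\<lambda>R. if R \<in> rels L
        then {xs \<in> tuples P (rel_arity L R). \<forall>\<^sub>F i in U. map (\<lambda>x. dec x i) xs \<in> rel_interp (N i) R}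
        else {})\<rparr>"

text \<open>The bound is \<mu> because strong submodels of this size exist around any \<mu> points
  of a factor, while \<mu> many conditions are still few enough for completeness. Good parts are the
  pieces from which the ultraproduct is assembled.\<close>

definition good :: "'v set \<Rightarrow> bool" where
  "good Q \<longleftrightarrow> Q \<subseteq> P \<and> |Q| \<le>o \<mu> \<and>
     (\<forall>\<^sub>F i in U. restrict_struct L (N i) ((\<lambda>x. dec x i) ` Q) \<prec> N i)"

lemma univ_ult [simp]: "univ ult = P"
  by (simp add: ult_def)

lemma Cinf: "Cinfinite \<mu>" and Card_order_\<mu>: "Card_order \<mu>"
  using LS Cinfinite_of_natLeq by (auto simp: LS_bound_def cardinal_def)

lemma small_less: "|Z| \<le>o \<mu> \<Longrightarrow> |Z| <o \<kappa>"
  using \<mu>\<kappa> ordLeq_ordLess_trans by blast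

lemma ev_ball:
  assumes "|Z| \<le>o \<mu>" "\<And>z. z \<in> Z \<Longrightarrow> \<forall>\<^sub>F i in U. R z i"
  shows "\<forall>\<^sub>F i in U. \<forall>z\<in>Z. R z i"
  by (rule complete_filter_ball[OF U(3) small_less[OF assms(1)] assms(2)])

lemma ev_I: "\<forall>\<^sub>F i in U. i \<in> I"
  using U(1) by (simp add: le_principal)

lemma ev_ex: "\<forall>\<^sub>F i in U. R i \<Longrightarrow> \<exists>i. R i"
  using U(2) eventually_happens' unfolding ultrafilter_def by blast

lemma ev_not: "\<not> (\<forall>\<^sub>F i in U. R i) \<Longrightarrow> \<forall>\<^sub>F i in U. \<not> R i"
  using U(2) unfolding ultrafilter_def by blast

lemma dec_tuples: "xs \<in> tuples P n \<Longrightarrow> i \<in> I \<Longrightarrow> map (\<lambda>x. dec x i) xs \<in> tuples (univ (N i)) n"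
  by (rule map_in_tuples) (auto intro: dec_in)

lemma ev_fun:
  assumes "f \<in> funs L" "xs \<in> tuples P (fun_arity L f)"
  shows "\<forall>\<^sub>F i in U. fun_interp (N i) f (map (\<lambda>x. dec x i) xs) \<in> univ (N i)"
  using ev_I
proof (rule eventually_mono)
  fix i assume i: "i \<in> I"
  show "fun_interp (N i) f (map (\<lambda>x. dec x i) xs) \<in> univ (N i)"
    by (rule fun_interp_closed[OF struct[OF N[OF i]] assms(1) dec_tuples[OF assms(2) i]])
qed

lemma ult_fun:
  assumes "f \<in> funs L" "xs \<in> tuples P (fun_arity L f)"
  shows "fun_interp ult f xs \<in> P"
    and "\<forall>\<^sub>F i in U. dec (fun_interp ult f xs) i = fun_interp (N i) f (map (\<lambda>x. dec x i) xs)"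
  using cls_in[OF ev_fun[OF assms]] dec_cls[OF ev_fun[OF assms]] assms by (auto simp: ult_def)

lemma ult_rel:
  assumes "R \<in> rels L" "xs \<in> tuples P (rel_arity L R)"
  shows "\<forall>\<^sub>F i in U. xs \<in> rel_interp ult R \<longleftrightarrow> map (\<lambda>x. dec x i) xs \<in> rel_interp (N i) R"
proof (cases "xs \<in> rel_interp ult R")
  case True
  then show ?thesis using assms by (simp add: ult_def)
next
  case False
  then show ?thesis using assms ev_not by (auto simp: ult_def)
qed

lemma ult_struct: "is_struct L ult"
proof -
  have "\<forall>\<^sub>F i in U. (SOME x. x \<in> univ (N i)) \<in> univ (N i)"
    using ev_I by (rule eventually_mono) (use N struct in \<open>auto simp: is_struct_def some_in_eq\<close>)
  from cls_in[OF this] have "P \<noteq> {}" by blast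
  then show ?thesis
    unfolding is_struct_def using small_P ult_fun(1) by (auto simp: ult_def restrict_def)
qed

text \<open>There are at most \<mu> pairs from \<open>Q\<close> and at most \<mu> combinations of a
  symbol with a list over \<open>Q\<close>. The distinctness of two points, the value of a function
  and the truth of a relation each transfer almost everywhere, hence all of them do so
  simultaneously.\<close>

lemma good_iso:
  assumes "good Q"
  shows "substruct L (restrict_struct L ult Q) ult"
    and "\<forall>\<^sub>F i in U. is_iso L (\<lambda>x. dec x i) (restrict_struct L ult Q)
           (restrict_struct L (N i) ((\<lambda>x. dec x i) ` Q))"
proof -
  have QP: "Q \<subseteq> P" and Q\<mu>: "|Q| \<le>o \<mu>"
    and ev: "\<forall>\<^sub>F i in U. restrict_struct L (N i) ((\<lambda>x. dec x i) ` Q) \<prec> N i"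
    using assms by (auto simp: good_def)
  have "|funs L| +c |rels L| \<le>o \<mu>" using LS by (simp add: LS_bound_def)
  then have "|funs L| \<le>o \<mu>" "|rels L| \<le>o \<mu>"
    using ordLeq_csum1 ordLeq_csum2 card_of_Card_order ordLeq_transitive by blast+
  then have card: "|funs L \<times> lists Q| \<le>o \<mu>" "|rels L \<times> lists Q| \<le>o \<mu>" "|Q \<times> Q| \<le>o \<mu>"
    using Q\<mu> card_of_lists[OF Cinf Q\<mu>] Cinf
    by (auto simp: cinfinite_def intro!: card_of_Times_ordLeq_infinite_Field)
  have closed: "fun_interp ult f xs \<in> Q" if f: "f \<in> funs L" and xs: "xs \<in> tuples Q (fun_arity L f)" for f xs
  proof -
    have xsP: "xs \<in> tuples P (fun_arity L f)" by (rule tuples_mono[OF QP xs])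
    \<comment> \<open>In almost every factor the value is the projection of some \<open>q\<close> in
      \<open>Q\<close>, which may depend on \<open>i\<close>. As \<open>Q\<close> has fewer than
      \<kappa> elements, one \<open>q\<close> serves on a large set, and \<open>dec_inj\<close>
      identifies it with the value.\<close>
    have "\<forall>\<^sub>F i in U. \<exists>q\<in>Q. dec (fun_interp ult f xs) i = dec q i"
      using ev ult_fun(2)[OF f xsP]
    proof eventually_elim
      case (elim i)
      have "map (\<lambda>x. dec x i) xs \<in> tuples ((\<lambda>x. dec x i) ` Q) (fun_arity L f)"
        by (rule map_in_tuples[OF _ xs]) simp
      then have "fun_interp (N i) f (map (\<lambda>x. dec x i) xs) \<in> (\<lambda>x. dec x i) ` Q"
        by (rule substruct_closed[OF prec_substruct[OF elim(1)] f])
      then show ?case using elim(2) by auto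
    qed
    then have "\<exists>q\<in>Q. \<forall>\<^sub>F i in U. dec (fun_interp ult f xs) i = dec q i"
      by (rule complete_ultrafilter_bex[OF U(3,2) small_less[OF Q\<mu>]])
    then obtain q where q: "q \<in> Q" "\<forall>\<^sub>F i in U. dec (fun_interp ult f xs) i = dec q i" by blast
    then have "fun_interp ult f xs = q" using dec_inj ult_fun(1)[OF f xsP] QP by blast
    then show ?thesis using q by simp
  qed
  have "Q \<noteq> {}"
  proof -
    obtain i where "restrict_struct L (N i) ((\<lambda>x. dec x i) ` Q) \<prec> N i" using ev_ex[OF ev] by blast
    then have "is_struct L (restrict_struct L (N i) ((\<lambda>x. dec x i) ` Q))"
      using prec_in struct by blast
    then show ?thesis by (auto simp: is_struct_def)
  qed
  then show sub: "substruct L (restrict_struct L ult Q) ult"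
    using closed QP by (intro substruct_restrict_struct ult_struct) auto
  have 1: "\<forall>\<^sub>F i in U. \<forall>(x, y)\<in>Q \<times> Q. x \<noteq> y \<longrightarrow> dec x i \<noteq> dec y i"
  proof (rule ev_ball[OF card(3)])
    fix z assume "z \<in> Q \<times> Q"
    then have z: "fst z \<in> P" "snd z \<in> P" using QP by auto
    show "\<forall>\<^sub>F i in U. case z of (x, y) \<Rightarrow> x \<noteq> y \<longrightarrow> dec x i \<noteq> dec y i"
    proof (cases "fst z = snd z")
      case False
      then have "\<not> (\<forall>\<^sub>F i in U. dec (fst z) i = dec (snd z) i)" using dec_inj[OF z] by blast
      then show ?thesis using ev_not by (auto simp: case_prod_beta)
    qed (simp add: case_prod_beta)
  qed
  have 2: "\<forall>\<^sub>F i in U. \<forall>(f, xs)\<in>funs L \<times> lists Q. xs \<in> tuples Q (fun_arity L f) \<longrightarrow>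
      dec (fun_interp ult f xs) i = fun_interp (N i) f (map (\<lambda>x. dec x i) xs)"
  proof (rule ev_ball[OF card(1)])
    fix z assume z: "z \<in> funs L \<times> lists Q"
    show "\<forall>\<^sub>F i in U. case z of (f, xs) \<Rightarrow> xs \<in> tuples Q (fun_arity L f) \<longrightarrow>
      dec (fun_interp ult f xs) i = fun_interp (N i) f (map (\<lambda>x. dec x i) xs)"
    proof (cases "snd z \<in> tuples Q (fun_arity L (fst z))")
      case True
      then show ?thesis
        using ult_fun(2)[of "fst z" "snd z"] z tuples_mono[OF QP True] by (auto simp: case_prod_beta)
    qed (simp add: case_prod_beta)
  qed
  have 3: "\<forall>\<^sub>F i in U. \<forall>(R, xs)\<in>rels L \<times> lists Q. xs \<in> tuples Q (rel_arity L R) \<longrightarrow>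
      (xs \<in> rel_interp ult R \<longleftrightarrow> map (\<lambda>x. dec x i) xs \<in> rel_interp (N i) R)"
  proof (rule ev_ball[OF card(2)])
    fix z assume z: "z \<in> rels L \<times> lists Q"
    show "\<forall>\<^sub>F i in U. case z of (R, xs) \<Rightarrow> xs \<in> tuples Q (rel_arity L R) \<longrightarrow>
      (xs \<in> rel_interp ult R \<longleftrightarrow> map (\<lambda>x. dec x i) xs \<in> rel_interp (N i) R)"
    proof (cases "snd z \<in> tuples Q (rel_arity L (fst z))")
      case True
      then show ?thesis
        using ult_rel[of "fst z" "snd z"] z tuples_mono[OF QP True] by (auto simp: case_prod_beta)
    qed (simp add: case_prod_beta)
  qed
  show "\<forall>\<^sub>F i in U. is_iso L (\<lambda>x. dec x i) (restrict_struct L ult Q)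
      (restrict_struct L (N i) ((\<lambda>x. dec x i) ` Q))"
    using ev 1 2 3
  proof eventually_elim
    case (elim i)
    let ?d = "\<lambda>x. dec x i"
    have tup: "xs \<in> lists Q" "map ?d xs \<in> tuples (?d ` Q) n" if "xs \<in> tuples Q n" for xs n
      using that map_in_tuples[OF subset_refl that] by (auto simp: tuples_def)
    show ?case
      unfolding is_iso_def
    proof (intro conjI ballI)
      show "is_struct L (restrict_struct L ult Q)" using sub by (simp add: substruct_def)
      show "is_struct L (restrict_struct L (N i) (?d ` Q))" using elim(1) prec_in struct by blast
      show "bij_betw ?d (univ (restrict_struct L ult Q)) (univ (restrict_struct L (N i) (?d ` Q)))"
        using elim(2) by (auto simp: bij_betw_def inj_on_def)
      show "?d (fun_interp (restrict_struct L ult Q) f xs) =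
          fun_interp (restrict_struct L (N i) (?d ` Q)) f (map ?d xs)"
        if "f \<in> funs L" "xs \<in> tuples (univ (restrict_struct L ult Q)) (fun_arity L f)" for f xs
        using that tup elim(3) by (simp add: restrict_struct_def)
      show "xs \<in> rel_interp (restrict_struct L ult Q) R \<longleftrightarrow>
          map ?d xs \<in> rel_interp (restrict_struct L (N i) (?d ` Q)) R"
        if "R \<in> rels L" "xs \<in> tuples (univ (restrict_struct L ult Q)) (rel_arity L R)" for R xs
        using that tup elim(4) by (simp add: restrict_struct_def)
    qed
  qed
qed

text \<open>In a suitable factor both projections are strong submodels of \<open>N i\<close>, so
  coherence compares them there; the inverse of the projection carries the comparison back.\<close>

lemma good_prec:
  assumes Q: "good Q" and Q': "good Q'" and sub: "Q \<subseteq> Q'"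
  shows "restrict_struct L ult Q \<prec> restrict_struct L ult Q'"
proof -
  have "\<forall>\<^sub>F i in U. restrict_struct L (N i) ((\<lambda>x. dec x i) ` Q) \<prec> N i"
    "\<forall>\<^sub>F i in U. restrict_struct L (N i) ((\<lambda>x. dec x i) ` Q') \<prec> N i"
    using assms by (auto simp: good_def)
  \<comment> \<open>The claim does not mention \<open>i\<close>, so a single coordinate that proves
    it is enough, and a large set supplies one.\<close>
  with good_iso(2)[OF Q] good_iso(2)[OF Q'] have "\<forall>\<^sub>F i in U. ?thesis"
  proof eventually_elim
    case (elim i)
    let ?d = "\<lambda>x. dec x i"
    have inj: "inj_on ?d Q'" using elim(2) by (simp add: is_iso_def bij_betw_def)
    have "restrict_struct L (N i) (?d ` Q) \<prec> restrict_struct L (N i) (?d ` Q')"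
    proof (rule coherence[OF elim(3,4)])
      show "substruct L (restrict_struct L (N i) (?d ` Q)) (restrict_struct L (N i) (?d ` Q'))"
        by (rule substruct_restrict_mono[OF prec_substruct[OF elim(3)] prec_substruct[OF elim(4)]])
          (use sub in blast)
    qed
    then show ?case
    proof (rule prec_iso_closed)
      show "is_iso L (inv_into Q' ?d) (restrict_struct L (N i) (?d ` Q')) (restrict_struct L ult Q')"
        by (rule is_iso_inverse[OF elim(2)]) (simp add: inv_into_f_f[OF inj])
      show "is_iso L (inv_into Q' ?d) (restrict_struct L (N i) (?d ` Q)) (restrict_struct L ult Q)"
        by (rule is_iso_inverse[OF elim(1)]) (use sub in \<open>simp add: subset_iff inv_into_f_f[OF inj]\<close>)
    qed
  qed
  then show ?thesis using ev_ex by blast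
qed

text \<open>Each factor has a strong submodel of size at most \<mu> around the projection of
  \<open>X\<close>. Enumerating all of them, possibly with repetitions, by the same index set
  \<open>Field \<mu>\<close> lines them up into \<mu> sections, whose classes form the good
  part.\<close>

lemma good_extend:
  assumes "X \<subseteq> P" "|X| \<le>o \<mu>"
  obtains Q where "good Q" "X \<subseteq> Q"
proof -
  have "\<exists>e. i \<in> I \<longrightarrow> (\<lambda>x. dec x i) ` X \<subseteq> e ` Field \<mu> \<and>
      restrict_struct L (N i) (e ` Field \<mu>) \<prec> N i" for i
  proof (cases "i \<in> I")
    case True
    have "(\<lambda>x. dec x i) ` X \<subseteq> univ (N i)" using dec_in assms(1) True by auto
    moreover have "|(\<lambda>x. dec x i) ` X| \<le>o \<mu>" using card_of_image assms(2) ordLeq_transitive by blast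
    ultimately obtain B where B: "B \<prec> N i" "(\<lambda>x. dec x i) ` X \<subseteq> univ B" "|univ B| \<le>o \<mu>"
      using LS_boundE[OF LS N[OF True]] by metis
    have "univ B \<noteq> {}" using B(1) prec_in struct by (auto simp: is_struct_def)
    moreover have "|univ B| \<le>o |Field \<mu>|" using B(3) ordLeq_Field[OF Card_order_\<mu>] by blast
    ultimately obtain e where e: "e ` Field \<mu> = univ B"
      using card_of_ordLeq2[of "univ B" "Field \<mu>"] by blast
    then show ?thesis
      using B restrict_struct_univ[OF prec_substruct[OF B(1)]] by (intro exI[of _ e]) simp
  qed simp
  then have "\<forall>i. \<exists>e. i \<in> I \<longrightarrow> (\<lambda>x. dec x i) ` X \<subseteq> e ` Field \<mu> \<and>
      restrict_struct L (N i) (e ` Field \<mu>) \<prec> N i" by (rule allI)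
  from choice[OF this] obtain e where e: "\<And>i. i \<in> I \<Longrightarrow> (\<lambda>x. dec x i) ` X \<subseteq> e i ` Field \<mu> \<and>
      restrict_struct L (N i) (e i ` Field \<mu>) \<prec> N i" by blast
  define q where "q z = cls (\<lambda>i. e i z)" for z
  have e_in: "\<forall>\<^sub>F i in U. e i z \<in> univ (N i)" if "z \<in> Field \<mu>" for z
    using ev_I
  proof (rule eventually_mono)
    fix i assume "i \<in> I"
    then have "e i ` Field \<mu> \<subseteq> univ (N i)"
      using prec_substruct[OF e[THEN conjunct2]] by (auto simp: substruct_def)
    then show "e i z \<in> univ (N i)" using that by blast
  qed
  have \<mu>\<mu>: "|Field \<mu>| \<le>o \<mu>" using card_of_Field_ordIso[OF Card_order_\<mu>] ordIso_imp_ordLeq by blast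
  have dq: "\<forall>\<^sub>F i in U. \<forall>z\<in>Field \<mu>. dec (q z) i = e i z"
    by (rule ev_ball[OF \<mu>\<mu>]) (use dec_cls[OF e_in] in \<open>simp add: q_def\<close>)
  show thesis
  proof
    have "|q ` Field \<mu>| \<le>o \<mu>" using card_of_image \<mu>\<mu> ordLeq_transitive by blast
    moreover have "q ` Field \<mu> \<subseteq> P" using cls_in[OF e_in] by (auto simp: q_def)
    moreover have "\<forall>\<^sub>F i in U. restrict_struct L (N i) ((\<lambda>x. dec x i) ` q ` Field \<mu>) \<prec> N i"
      using dq ev_I
    proof eventually_elim
      case (elim i)
      then have "(\<lambda>x. dec x i) ` q ` Field \<mu> = e i ` Field \<mu>" by (auto simp: image_image)
      then show ?case using e elim(2) by simp
    qed
    ultimately show "good (q ` Field \<mu>)" by (simp add: good_def)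
    show "X \<subseteq> q ` Field \<mu>"
    proof
      fix x assume x: "x \<in> X"
      \<comment> \<open>The index at which \<open>x\<close> is listed may vary with the coordinate;
        completeness makes it constant on a large set, so \<open>x\<close> is literally one of the
        classes.\<close>
      have "\<forall>\<^sub>F i in U. \<exists>z\<in>Field \<mu>. dec x i = dec (q z) i"
        using dq ev_I
      proof eventually_elim
        case (elim i)
        then have "dec x i \<in> e i ` Field \<mu>" using e x by blast
        then show ?case using elim(1) by auto
      qed
      then have "\<exists>z\<in>Field \<mu>. \<forall>\<^sub>F i in U. dec x i = dec (q z) i"
        by (rule complete_ultrafilter_bex[OF U(3,2) small_less[OF \<mu>\<mu>]])
      then obtain z where z: "z \<in> Field \<mu>" "\<forall>\<^sub>F i in U. dec x i = dec (q z) i" by blast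
      moreover have "q z \<in> P" using cls_in[OF e_in[OF z(1)]] by (simp add: q_def)
      ultimately have "x = q z" using dec_inj x assms(1) by blast
      then show "x \<in> q ` Field \<mu>" using z by simp
    qed
  qed
qed

section \<open>The ultraproduct as a directed union, and embeddings into it\<close>

lemma good_elts_set_of: "good Q \<Longrightarrow> elts (set_of Q) = Q"
  by (rule elts_set_of[OF small_subset[OF small_P]]) (simp add: good_def)

lemma ult_union:
  shows ult_in_K: "ult \<in> K" and good_prec_ult: "\<And>Q. good Q \<Longrightarrow> restrict_struct L ult Q \<prec> ult"
proof -
  define D where "D = {v. good (elts v)}"
  have DI: "set_of Q \<in> D" "elts (set_of Q) = Q" if "good Q" for Q
    using good_elts_set_of[OF that] that by (simp_all add: D_def)
  have ext: "\<exists>v\<in>D. X \<subseteq> elts v" if "X \<subseteq> P" "|X| \<le>o \<mu>" for X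
    using good_extend[OF that] DI by metis
  have un: "(\<Union>v\<in>D. elts v) = P"
  proof
    show "P \<subseteq> (\<Union>v\<in>D. elts v)"
    proof
      fix x assume "x \<in> P"
      moreover have "|{x}| \<le>o \<mu>"
        using Cinf by (metis Card_order_singl_ordLeq cinfinite_def finite.emptyI)
      ultimately show "x \<in> (\<Union>v\<in>D. elts v)" using ext[of "{x}"] by blast
    qed
  qed (auto simp: D_def good_def)
  have "restrict_struct L ult (\<Union>v\<in>D. elts v) \<in> K \<and>
    (\<forall>v\<in>D. restrict_struct L ult (elts v) \<prec> restrict_struct L ult (\<Union>v\<in>D. elts v)) \<and>
    (\<forall>M. (\<forall>v\<in>D. restrict_struct L ult (elts v) \<prec> M) \<longrightarrow> restrict_struct L ult (\<Union>v\<in>D. elts v) \<prec> M)"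
  proof (rule directed_union[OF ult_struct])
    show "D \<subseteq> {v. elts v \<subseteq> univ ult}" by (auto simp: D_def good_def)
    show "D \<noteq> {}" using un ult_struct by (auto simp: is_struct_def)
    show "\<forall>u\<in>D. \<forall>v\<in>D. elts u \<subseteq> elts v \<longrightarrow>
        restrict_struct L ult (elts u) \<prec> restrict_struct L ult (elts v)"
      using good_prec by (simp add: D_def)
    \<comment> \<open>The union of two good parts need not be good, but its size is still at most
      \<mu>, so it extends to a good part.\<close>
    show "\<forall>u\<in>D. \<forall>v\<in>D. \<exists>w\<in>D. elts u \<union> elts v \<subseteq> elts w"
    proof (intro ballI)
      fix u v assume "u \<in> D" "v \<in> D"
      then show "\<exists>w\<in>D. elts u \<union> elts v \<subseteq> elts w"
        using Cinf by (intro ext Un_Cinfinite_bound) (auto simp: D_def good_def)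
    qed
    show "\<forall>v\<in>D. substruct L (restrict_struct L ult (elts v)) ult"
      using good_iso(1) by (simp add: D_def)
  qed
  moreover have "restrict_struct L ult (\<Union>v\<in>D. elts v) = ult"
    using restrict_struct_univ[OF substruct_refl[OF ult_struct]] un by simp
  ultimately have *: "ult \<in> K" "\<And>v. v \<in> D \<Longrightarrow> restrict_struct L ult (elts v) \<prec> ult" by simp_all
  show "ult \<in> K" by (rule *)
  show "\<And>Q. good Q \<Longrightarrow> restrict_struct L ult Q \<prec> ult" using *(2) DI by metis
qed

text \<open>The large set in \<open>emb\<close> depends on \<open>A\<close>; no single
  \<open>f i\<close> need be an embedding of all of \<open>M\<close>. The limit map sends each small
  submodel onto a good part, and smoothness assembles these images into a strong submodel.\<close>

lemma embedding_ult:
  assumes M: "M \<in> K"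
    and emb: "\<And>A. A \<prec> M \<Longrightarrow> |univ A| \<le>o \<mu> \<Longrightarrow> \<forall>\<^sub>F i in U. K_embedding L (\<prec>) (f i) A (N i)"
  shows "K_embedding L (\<prec>) (\<lambda>x. cls (\<lambda>i. f i x)) M ult"
proof -
  define F where "F x = cls (\<lambda>i. f i x)" for x
  have image: "\<forall>\<^sub>F i in U. is_iso L (f i) A (restrict_struct L (N i) (f i ` univ A)) \<and>
      restrict_struct L (N i) (f i ` univ A) \<prec> N i"
    if A: "A \<prec> M" "|univ A| \<le>o \<mu>" for A
    using emb[OF A]
  proof (rule eventually_mono)
    fix i assume "K_embedding L (\<prec>) (f i) A (N i)"
    then obtain N' where N': "N' \<prec> N i" "is_iso L (f i) A N'" unfolding K_embedding_def by blast
    then show "is_iso L (f i) A (restrict_struct L (N i) (f i ` univ A)) \<and>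
      restrict_struct L (N i) (f i ` univ A) \<prec> N i"
      using is_iso_substruct_image[OF N'(2) prec_substruct[OF N'(1)]] by simp
  qed
  have in_N: "\<forall>\<^sub>F i in U. f i x \<in> univ (N i)" if A: "A \<prec> M" "|univ A| \<le>o \<mu>" and x: "x \<in> univ A" for A x
    using image[OF A]
  proof (rule eventually_mono)
    fix i assume i: "is_iso L (f i) A (restrict_struct L (N i) (f i ` univ A)) \<and>
      restrict_struct L (N i) (f i ` univ A) \<prec> N i"
    have "f i ` univ A \<subseteq> univ (N i)"
      using prec_substruct[OF conjunct2[OF i]] by (simp add: substruct_def)
    then show "f i x \<in> univ (N i)" using x by blast
  qed
  have dF: "\<forall>\<^sub>F i in U. \<forall>x\<in>univ A. dec (F x) i = f i x" if A: "A \<prec> M" "|univ A| \<le>o \<mu>" for A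
    by (rule ev_ball[OF A(2)]) (use dec_cls[OF in_N[OF A]] in \<open>simp add: F_def\<close>)
  have good: "good (F ` univ A)" if A: "A \<prec> M" "|univ A| \<le>o \<mu>" for A
    unfolding good_def
  proof (intro conjI)
    show "F ` univ A \<subseteq> P" using cls_in[OF in_N[OF A]] by (auto simp: F_def)
    show "|F ` univ A| \<le>o \<mu>" using card_of_image A(2) ordLeq_transitive by blast
    show "\<forall>\<^sub>F i in U. restrict_struct L (N i) ((\<lambda>x. dec x i) ` F ` univ A) \<prec> N i"
      using dF[OF A] image[OF A]
    proof eventually_elim
      case (elim i)
      then have "(\<lambda>x. dec x i) ` F ` univ A = f i ` univ A" by (auto simp: image_image)
      then show ?case using elim(2) by simp
    qed
  qed
  have iso: "is_iso L F A (restrict_struct L ult (F ` univ A))" if A: "A \<prec> M" "|univ A| \<le>o \<mu>" for A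
  proof -
    have "\<forall>\<^sub>F i in U. ?thesis"
      using dF[OF A] image[OF A] good_iso(2)[OF good[OF A]]
    proof eventually_elim
      case (elim i)
      then have im: "(\<lambda>x. dec x i) ` F ` univ A = f i ` univ A" by (auto simp: image_image)
      show ?case
        by (rule is_iso_cancel_left[OF elim(3)[unfolded im] conjunct1[OF elim(2)]]) (simp_all add: elim(1))
    qed
    then show ?thesis using ev_ex by blast
  qed
  have cover: "\<exists>A. A \<prec> M \<and> |univ A| \<le>o \<mu> \<and> X \<subseteq> univ A" if "X \<subseteq> univ M" "|X| \<le>o \<mu>" for X
    using LS_boundE[OF LS M that] by metis
  have fin: "|X| \<le>o \<mu>" if "finite X" for X :: "'v set"
    using Cinf that
    by (intro ordLess_imp_ordLeq finite_ordLess_infinite)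
      (auto simp: cinfinite_def Field_card_of card_of_well_order_on card_order_on_well_order_on)
  \<comment> \<open>Only images of small submodels are taken, not all good parts: the union must be
    the image of \<open>M\<close>, so that smoothness applies to it with \<open>ult\<close> as the
    upper bound.\<close>
  define D where "D = {v. \<exists>A. A \<prec> M \<and> |univ A| \<le>o \<mu> \<and> elts v = F ` univ A}"
  have DI: "set_of (F ` univ A) \<in> D" "elts (set_of (F ` univ A)) = F ` univ A"
    if "A \<prec> M" "|univ A| \<le>o \<mu>" for A
    using good_elts_set_of[OF good[OF that]] that by (auto simp: D_def)
  have good_D: "good (elts v)" if "v \<in> D" for v
    using that good by (auto simp: D_def)
  have AM: "univ A \<subseteq> univ M" if "A \<prec> M" for A
    using prec_substruct[OF that] by (simp add: substruct_def)
  have un: "(\<Union>v\<in>D. elts v) = F ` univ M"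
  proof
    show "(\<Union>v\<in>D. elts v) \<subseteq> F ` univ M" using AM by (force simp: D_def)
    show "F ` univ M \<subseteq> (\<Union>v\<in>D. elts v)"
    proof
      fix y assume "y \<in> F ` univ M"
      then obtain x where x: "x \<in> univ M" "y = F x" by blast
      then obtain A where "A \<prec> M" "|univ A| \<le>o \<mu>" "x \<in> univ A" using cover[of "{x}"] fin by blast
      then show "y \<in> (\<Union>v\<in>D. elts v)" using DI[of A] x(2) by blast
    qed
  qed
  have "restrict_struct L ult (\<Union>v\<in>D. elts v) \<in> K \<and>
    (\<forall>v\<in>D. restrict_struct L ult (elts v) \<prec> restrict_struct L ult (\<Union>v\<in>D. elts v)) \<and>
    (\<forall>M. (\<forall>v\<in>D. restrict_struct L ult (elts v) \<prec> M) \<longrightarrow> restrict_struct L ult (\<Union>v\<in>D. elts v) \<prec> M)"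
  proof (rule directed_union[OF ult_struct])
    show "D \<subseteq> {v. elts v \<subseteq> univ ult}" using good_D by (auto simp: good_def)
    show "D \<noteq> {}" using un M struct[OF M] by (auto simp: is_struct_def)
    show "\<forall>u\<in>D. \<forall>v\<in>D. elts u \<subseteq> elts v \<longrightarrow>
        restrict_struct L ult (elts u) \<prec> restrict_struct L ult (elts v)"
      using good_prec good_D by blast
    show "\<forall>u\<in>D. \<forall>v\<in>D. \<exists>w\<in>D. elts u \<union> elts v \<subseteq> elts w"
    proof (intro ballI)
      fix u v assume "u \<in> D" "v \<in> D"
      then obtain A B where AB: "A \<prec> M" "|univ A| \<le>o \<mu>" "elts u = F ` univ A"
        "B \<prec> M" "|univ B| \<le>o \<mu>" "elts v = F ` univ B" by (auto simp: D_def)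
      have "|univ A \<union> univ B| \<le>o \<mu>" using AB Cinf by (intro Un_Cinfinite_bound)
      then obtain C where "C \<prec> M" "|univ C| \<le>o \<mu>" "univ A \<union> univ B \<subseteq> univ C"
        using cover[of "univ A \<union> univ B"] AM[OF AB(1)] AM[OF AB(4)] by blast
      then show "\<exists>w\<in>D. elts u \<union> elts v \<subseteq> elts w"
        using DI[of C] AB(3,6) by (intro bexI[of _ "set_of (F ` univ C)"]) auto
    qed
    show "\<forall>v\<in>D. substruct L (restrict_struct L ult (elts v)) ult"
      using good_iso(1) good_D by blast
  qed
  moreover have "\<forall>v\<in>D. restrict_struct L ult (elts v) \<prec> ult" using good_prec_ult good_D by blast
  ultimately have FM: "restrict_struct L ult (F ` univ M) \<prec> ult" unfolding un by blast
  \<comment> \<open>Every tuple is finite and so lies in a small submodel; the clauses of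
    \<open>is_iso\<close> for functions and relations are inherited from there.\<close>
  have local: "\<exists>A. A \<prec> M \<and> |univ A| \<le>o \<mu> \<and> xs \<in> tuples (univ A) n"
    if "xs \<in> tuples (univ M) n" for xs n
    using cover[of "set xs"] fin[of "set xs"] that by (auto simp: tuples_def)
  have "is_iso L F M (restrict_struct L ult (F ` univ M))"
    unfolding is_iso_def
  proof (intro conjI ballI)
    show "is_struct L M" by (rule struct[OF M])
    show "is_struct L (restrict_struct L ult (F ` univ M))" using FM prec_in struct by blast
    have "inj_on F (univ M)"
    proof (rule inj_onI)
      fix x y assume xy: "x \<in> univ M" "y \<in> univ M" "F x = F y"
      then obtain A where A: "A \<prec> M" "|univ A| \<le>o \<mu>" "x \<in> univ A" "y \<in> univ A"
        using cover[of "{x, y}"] fin[of "{x, y}"] by auto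
      then have "inj_on F (univ A)" using iso by (auto simp: is_iso_def bij_betw_def)
      then show "x = y" using A xy(3) by (auto dest: inj_onD)
    qed
    then show "bij_betw F (univ M) (univ (restrict_struct L ult (F ` univ M)))"
      by (simp add: bij_betw_def)
  next
    fix g xs assume g: "g \<in> funs L" and xs: "xs \<in> tuples (univ M) (fun_arity L g)"
    then obtain A where A: "A \<prec> M" "|univ A| \<le>o \<mu>" and xsA: "xs \<in> tuples (univ A) (fun_arity L g)"
      using local by blast
    have tup: "map F xs \<in> tuples (F ` univ A) (fun_arity L g)"
      "map F xs \<in> tuples (F ` univ M) (fun_arity L g)"
      using map_in_tuples[OF subset_refl xs] map_in_tuples[OF subset_refl xsA] by auto
    have "fun_interp M g xs = fun_interp A g xs"
      using prec_substruct[OF A(1)] g xsA by (simp add: substruct_def)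
    then show "F (fun_interp M g xs) = fun_interp (restrict_struct L ult (F ` univ M)) g (map F xs)"
      using iso[OF A] g xsA tup by (simp add: is_iso_def restrict_struct_def)
  next
    fix R xs assume R: "R \<in> rels L" and xs: "xs \<in> tuples (univ M) (rel_arity L R)"
    then obtain A where A: "A \<prec> M" "|univ A| \<le>o \<mu>" and xsA: "xs \<in> tuples (univ A) (rel_arity L R)"
      using local by blast
    have tup: "map F xs \<in> tuples (F ` univ A) (rel_arity L R)"
      "map F xs \<in> tuples (F ` univ M) (rel_arity L R)"
      using map_in_tuples[OF subset_refl xs] map_in_tuples[OF subset_refl xsA] by auto
    have "xs \<in> rel_interp M R \<longleftrightarrow> xs \<in> rel_interp A R"
      using prec_substruct[OF A(1)] R xsA by (simp add: substruct_def)
    then show "xs \<in> rel_interp M R \<longleftrightarrow> map F xs \<in> rel_interp (restrict_struct L ult (F ` univ M)) R"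
      using iso[OF A] R xsA tup by (simp add: is_iso_def restrict_struct_def)
  qed
  with FM have "K_embedding L (\<prec>) F M ult" unfolding K_embedding_def by blast
  moreover have "F = (\<lambda>x. cls (\<lambda>i. f i x))" by (simp add: F_def fun_eq_iff)
  ultimately show ?thesis by simp
qed

end

section \<open>Transfer of joint embedding and amalgamation\<close>

lemma is_iso_inj: "is_iso L f M N \<Longrightarrow> inj_on f (univ M)"
  by (simp add: is_iso_def bij_betw_def)

lemma models_on_card_atLeast:
  "M \<in> models_on K (card_atLeast \<mu>) \<Longrightarrow> M \<in> K \<and> \<mu> \<le>o |univ M|"
  using ordLeq_ordIso_trans ordIso_symmetric unfolding models_on_def card_atLeast_def by blast

context AEC
begin

section \<open>Submodels of intermediate size and joint embeddings\<close>

lemma LS_bound_mono: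
  assumes "LS_bound L K (\<prec>) \<theta>" "cardinal \<mu>" "\<theta> \<le>o \<mu>"
  shows "LS_bound L K (\<prec>) \<mu>"
  unfolding LS_bound_def
proof (intro conjI ballI allI impI)
  show "natLeq \<le>o \<mu>" "|funs L| +c |rels L| \<le>o \<mu>"
    using assms(1,3) ordLeq_transitive unfolding LS_bound_def by blast+
  fix M A assume "M \<in> K" "A \<subseteq> univ M"
  then obtain B where "B \<prec> M" "A \<subseteq> univ B" "|univ B| \<le>o |A| +c \<theta>"
    using assms(1) unfolding LS_bound_def by blast
  then show "\<exists>B. B \<prec> M \<and> A \<subseteq> univ B \<and> |univ B| \<le>o |A| +c \<mu>"
    using csum_mono2[OF assms(3)] ordLeq_transitive by blast
qed (rule assms(2))

lemma prec_of_subset: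
  assumes "A \<prec> M" "B \<prec> M" "univ A \<subseteq> univ B"
  shows "A \<prec> B"
proof (rule coherence[OF assms(1,2)])
  have "restrict_struct L M (univ A) = A" "restrict_struct L M (univ B) = B"
    by (intro restrict_struct_univ prec_substruct assms)+
  then show "substruct L A B"
    using substruct_restrict_mono[of L M "univ A" "univ B"] prec_substruct[OF assms(1)]
      prec_substruct[OF assms(2)] assms(3) by simp
qed

lemma K_embedding_restrict:
  assumes f: "K_embedding L (\<prec>) f M N" and A: "A \<prec> M"
  shows "K_embedding L (\<prec>) f A N"
proof -
  obtain N' where N': "N' \<prec> N" "is_iso L f M N'" using f unfolding K_embedding_def by blast
  note iso = is_iso_restrict(1)[OF N'(2) prec_substruct[OF A]]
  have "restrict_struct L N' (f ` univ A) \<prec> N'" by (rule prec_iso_closed[OF A N'(2) iso])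
  then show ?thesis using iso N'(1) prec_trans unfolding K_embedding_def by blast
qed

text \<open>A submodel around \<open>Y\<close> alone might be smaller than \<mu> and so outside the
  hypotheses. Adding an injective image of \<open>Field \<mu>\<close> forces the lower bound, and
  the size stays below \<kappa> because \<kappa> is an infinite cardinal.\<close>

lemma medium_submodel:
  assumes LS: "LS_bound L K (\<prec>) \<mu>" and \<kappa>: "Cinfinite \<kappa>" and \<mu>\<kappa>: "\<mu> <o \<kappa>"
    and M: "M \<in> K" "\<mu> \<le>o |univ M|" and Y: "Y \<subseteq> univ M" "|Y| <o \<kappa>"
  shows "\<exists>B\<in>models_on K (card_atLeastLessThan \<mu> \<kappa>). B \<prec> M \<and> Y \<subseteq> univ B"
proof -
  have \<mu>: "Card_order \<mu>" using LS by (simp add: LS_bound_def cardinal_def)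
  have \<mu>F: "\<mu> =o |Field \<mu>|" using card_of_Field_ordIso[OF \<mu>] ordIso_symmetric by blast
  have "|Field \<mu>| \<le>o |univ M|" using card_of_Field_ordIso[OF \<mu>] M(2) ordIso_ordLeq_trans by blast
  then obtain g where g: "inj_on g (Field \<mu>)" "g ` Field \<mu> \<subseteq> univ M"
    unfolding card_of_ordLeq[symmetric] by blast
  let ?Z = "g ` Field \<mu>"
  have Z: "|Field \<mu>| =o |?Z|" using g(1) by (intro card_of_ordIsoI) (auto simp: bij_betw_def)
  have "|?Z| =o \<mu>" using Z \<mu>F ordIso_symmetric ordIso_transitive by blast
  then have "|?Z| <o \<kappa>" using \<mu>\<kappa> ordIso_ordLess_trans by blast
  then have YZ: "|Y \<union> ?Z| <o \<kappa>" using Y(2) \<kappa> by (intro Un_Cinfinite_bound_strict)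
  obtain B where B: "B \<prec> M" "Y \<union> ?Z \<subseteq> univ B" "|univ B| \<le>o |Y \<union> ?Z| +c \<mu>"
    using LS M(1) Y(1) g(2) unfolding LS_bound_def by (metis Un_least)
  have "|Field \<mu>| <o \<kappa>" using \<mu>F \<mu>\<kappa> ordIso_symmetric ordIso_ordLess_trans by blast
  then have "|(Y \<union> ?Z) <+> Field \<mu>| <o \<kappa>"
    using YZ \<kappa> by (intro card_of_Plus_ordLess_infinite_Field) (auto simp: cinfinite_def)
  then have less: "|univ B| <o \<kappa>"
    using B(3) ordLeq_ordLess_trans unfolding csum_def Field_card_of by blast
  have "|?Z| \<le>o |univ B|" using B(2) by (intro card_of_mono1) blast
  then have geq: "\<mu> \<le>o |univ B|" using \<mu>F Z ordIso_ordLeq_trans by blast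
  have BK: "B \<in> K" using B(1) prec_in by blast
  then have "cardinal |univ B|"
    using struct unfolding cardinal_def is_struct_def Field_card_of by (auto simp: card_of_card_order_on)
  then have "B \<in> models_on K (card_atLeastLessThan \<mu> \<kappa>)"
    using less geq BK card_of_refl unfolding models_on_def card_atLeastLessThan_def by blast
  then show ?thesis using B by blast
qed

text \<open>
  \<open>\<Phi>\<close> collects the side conditions on the embeddings of the small submodels; equality of the two
  limit embeddings at a pair of points is decided by a large set of the small ones.
\<close>

lemma joint_embedding_transfer:
  fixes \<kappa> \<mu> :: "'v rel"
  assumes LS: "LS_bound L K (\<prec>) \<mu>" and sc: "strongly_compact \<kappa>" and \<mu>\<kappa>: "\<mu> <o \<kappa>"
    and M: "M\<^sub>1 \<in> K" "M\<^sub>2 \<in> K"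
    and loc: "\<And>Y. Y \<subseteq> univ M\<^sub>1 \<union> univ M\<^sub>2 \<Longrightarrow> |Y| <o \<kappa> \<Longrightarrow> \<exists>B\<^sub>1 B\<^sub>2 N g\<^sub>1 g\<^sub>2.
      B\<^sub>1 \<prec> M\<^sub>1 \<and> B\<^sub>2 \<prec> M\<^sub>2 \<and> Y \<inter> univ M\<^sub>1 \<subseteq> univ B\<^sub>1 \<and> Y \<inter> univ M\<^sub>2 \<subseteq> univ B\<^sub>2 \<and> N \<in> K \<and>
      K_embedding L (\<prec>) g\<^sub>1 B\<^sub>1 N \<and> K_embedding L (\<prec>) g\<^sub>2 B\<^sub>2 N \<and> \<Phi> Y g\<^sub>1 g\<^sub>2"
  obtains N f\<^sub>1 f\<^sub>2 where "N \<in> K" "K_embedding L (\<prec>) f\<^sub>1 M\<^sub>1 N" "K_embedding L (\<prec>) f\<^sub>2 M\<^sub>2 N"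
    "\<And>x y. x \<in> univ M\<^sub>1 \<Longrightarrow> y \<in> univ M\<^sub>2 \<Longrightarrow> f\<^sub>1 x = f\<^sub>2 y \<Longrightarrow>
      \<exists>Y g\<^sub>1 g\<^sub>2. x \<in> Y \<and> y \<in> Y \<and> \<Phi> Y g\<^sub>1 g\<^sub>2 \<and> g\<^sub>1 x = g\<^sub>2 y"
    "\<And>x y. x \<in> univ M\<^sub>1 \<Longrightarrow> y \<in> univ M\<^sub>2 \<Longrightarrow>
      (\<And>Y g\<^sub>1 g\<^sub>2. x \<in> Y \<Longrightarrow> y \<in> Y \<Longrightarrow> \<Phi> Y g\<^sub>1 g\<^sub>2 \<Longrightarrow> g\<^sub>1 x = g\<^sub>2 y) \<Longrightarrow> f\<^sub>1 x = f\<^sub>2 y"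
proof -
  have \<mu>: "Cinfinite \<mu>" using LS Cinfinite_of_natLeq by (auto simp: LS_bound_def cardinal_def)
  have \<kappa>: "Cinfinite \<kappa>"
    using sc \<mu> \<mu>\<kappa> cinfinite_mono ordLess_imp_ordLeq unfolding strongly_compact_def cardinal_def by blast
  \<comment> \<open>The universes may overlap, and in amalgamation they share that of
    \<open>M\<^sub>0\<close>. One index set of parts of the union serves both models, which is why
    \<open>loc\<close> intersects \<open>Y\<close> with each universe.\<close>
  define V where "V = univ M\<^sub>1 \<union> univ M\<^sub>2"
  have V: "small V" unfolding V_def using M struct by (intro small_Un) (auto simp: is_struct_def)
  define I where "I = small_parts \<kappa> V"
  define \<Psi> where "\<Psi> i B\<^sub>1 B\<^sub>2 N g\<^sub>1 g\<^sub>2 \<longleftrightarrow>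
      B\<^sub>1 \<prec> M\<^sub>1 \<and> B\<^sub>2 \<prec> M\<^sub>2 \<and> elts i \<inter> univ M\<^sub>1 \<subseteq> univ B\<^sub>1 \<and> elts i \<inter> univ M\<^sub>2 \<subseteq> univ B\<^sub>2 \<and> N \<in> K \<and>
      K_embedding L (\<prec>) g\<^sub>1 B\<^sub>1 N \<and> K_embedding L (\<prec>) g\<^sub>2 B\<^sub>2 N \<and> \<Phi> (elts i) g\<^sub>1 g\<^sub>2"
    for i B\<^sub>1 B\<^sub>2 N g\<^sub>1 g\<^sub>2
  have "\<forall>i\<in>I. \<exists>B\<^sub>1 B\<^sub>2 N g\<^sub>1 g\<^sub>2. \<Psi> i B\<^sub>1 B\<^sub>2 N g\<^sub>1 g\<^sub>2"
    unfolding \<Psi>_def I_def small_parts_def V_def by (intro ballI loc) auto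
  then obtain B\<^sub>1 B\<^sub>2 N g\<^sub>1 g\<^sub>2 where \<Psi>: "\<And>i. i \<in> I \<Longrightarrow> \<Psi> i (B\<^sub>1 i) (B\<^sub>2 i) (N i) (g\<^sub>1 i) (g\<^sub>2 i)"
    by metis
  obtain U where U: "U \<le> principal I" "ultrafilter U" "complete_filter \<kappa> U"
    and fine: "\<And>Y. Y \<subseteq> V \<Longrightarrow> |Y| <o \<kappa> \<Longrightarrow> \<forall>\<^sub>F i in U. Y \<subseteq> elts i"
    using fine_ultrafilter[OF sc \<kappa> V] unfolding I_def by metis
  have N: "N i \<in> K" if "i \<in> I" for i using \<Psi>[OF that] by (simp add: \<Psi>_def)
  have I: "small I" unfolding I_def by (rule small_small_parts[OF V])
  have uN: "small (univ (N i))" "univ (N i) \<noteq> {}" if "i \<in> I" for i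
    using struct[OF N[OF that]] by (auto simp: is_struct_def)
  obtain P :: "'v set" and dec cls where P: "small P"
    "\<And>x i. x \<in> P \<Longrightarrow> i \<in> I \<Longrightarrow> dec x i \<in> univ (N i)"
    "\<And>x y. x \<in> P \<Longrightarrow> y \<in> P \<Longrightarrow> \<forall>\<^sub>F i in U. dec x i = dec y i \<Longrightarrow> x = y"
    "\<And>g. \<forall>\<^sub>F i in U. g i \<in> univ (N i) \<Longrightarrow> cls g \<in> P"
    "\<And>g. \<forall>\<^sub>F i in U. g i \<in> univ (N i) \<Longrightarrow> \<forall>\<^sub>F i in U. dec (cls g) i = g i"
    using reduced_product_carrier[of I "\<lambda>i. univ (N i)" U, OF I uN U(1)] by blast
  interpret complete_ultraproduct L K "(\<prec>)" \<kappa> \<mu> I U N P dec cls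
    by unfold_locales (use LS \<mu>\<kappa> U N P in auto)
  have evI: "\<forall>\<^sub>F i in U. i \<in> I" by (rule ev_I)
  have emb: "\<forall>\<^sub>F i in U. K_embedding L (\<prec>) (g i) A (N i)"
    if B: "\<And>i. i \<in> I \<Longrightarrow>
        B i \<prec> M \<and> elts i \<inter> univ M \<subseteq> univ (B i) \<and> K_embedding L (\<prec>) (g i) (B i) (N i)"
      and MV: "univ M \<subseteq> V" and A: "A \<prec> M" "|univ A| \<le>o \<mu>" for B M g A
  proof -
    have AM: "univ A \<subseteq> univ M" using prec_substruct[OF A(1)] by (simp add: substruct_def)
    \<comment> \<open>Fineness puts \<open>A\<close> inside almost every part \<open>elts i\<close>,
      hence inside \<open>B i\<close>. By coherence it is then a strong submodel of
      \<open>B i\<close>, and the embedding of \<open>B i\<close> restricts to it.\<close>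
    then have "\<forall>\<^sub>F i in U. univ A \<subseteq> elts i" using MV by (intro fine small_less A(2)) blast
    then show ?thesis using evI
    proof eventually_elim
      case (elim i)
      then have "A \<prec> B i" using B[of i] AM by (intro prec_of_subset[OF A(1)]) blast+
      then show ?case using B[OF elim(2)] K_embedding_restrict by blast
    qed
  qed
  have emb1: "\<forall>\<^sub>F i in U. K_embedding L (\<prec>) (g\<^sub>1 i) A (N i)" if "A \<prec> M\<^sub>1" "|univ A| \<le>o \<mu>" for A
    by (rule emb[where B = B\<^sub>1 and M = M\<^sub>1]) (use \<Psi> that in \<open>auto simp: \<Psi>_def V_def\<close>)
  have emb2: "\<forall>\<^sub>F i in U. K_embedding L (\<prec>) (g\<^sub>2 i) A (N i)" if "A \<prec> M\<^sub>2" "|univ A| \<le>o \<mu>" for A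
    by (rule emb[where B = B\<^sub>2 and M = M\<^sub>2]) (use \<Psi> that in \<open>auto simp: \<Psi>_def V_def\<close>)
  have fin: "|X| <o \<kappa>" if "finite X" for X :: "'v set"
    using \<kappa> that
    by (intro finite_ordLess_infinite)
      (auto simp: cinfinite_def Field_card_of card_of_well_order_on card_order_on_well_order_on)
  \<comment> \<open>The class map is controlled only for functions that are almost everywhere
    sections. To see this at \<open>x\<close>, a small submodel containing \<open>x\<close> is
    used.\<close>
  have val: "\<forall>\<^sub>F i in U. g i x \<in> univ (N i)"
    if M: "M \<in> K" and x: "x \<in> univ M"
      and emb: "\<And>A. A \<prec> M \<Longrightarrow> |univ A| \<le>o \<mu> \<Longrightarrow> \<forall>\<^sub>F i in U. K_embedding L (\<prec>) (g i) A (N i)" for M g x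
  proof -
    have "|{x}| \<le>o \<mu>" using \<mu> by (metis Card_order_singl_ordLeq cinfinite_def finite.emptyI)
    then obtain A where A: "A \<prec> M" "{x} \<subseteq> univ A" "|univ A| \<le>o \<mu>"
      using LS_boundE[OF LS M, of "{x}"] x by blast
    show ?thesis using emb[OF A(1,3)]
    proof (rule eventually_mono)
      fix i assume "K_embedding L (\<prec>) (g i) A (N i)"
      then obtain N' where N': "N' \<prec> N i" "is_iso L (g i) A N'" unfolding K_embedding_def by blast
      have "g i x \<in> univ N'" using N'(2) A(2) by (auto simp: is_iso_def bij_betw_def)
      then show "g i x \<in> univ (N i)" using prec_substruct[OF N'(1)] by (auto simp: substruct_def)
    qed
  qed
  have ev_pair: "\<forall>\<^sub>F i in U. i \<in> I \<and> x \<in> elts i \<and> y \<in> elts i \<and> \<Phi> (elts i) (g\<^sub>1 i) (g\<^sub>2 i)"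
    if "x \<in> univ M\<^sub>1" "y \<in> univ M\<^sub>2" for x y
  proof -
    have "\<forall>\<^sub>F i in U. {x, y} \<subseteq> elts i" by (intro fine fin) (use that in \<open>auto simp: V_def\<close>)
    then show ?thesis using evI by eventually_elim (use \<Psi> in \<open>auto simp: \<Psi>_def\<close>)
  qed
  show thesis
  proof (rule that)
    show "ult \<in> K" by (rule ult_in_K)
    show "K_embedding L (\<prec>) (\<lambda>x. cls (\<lambda>i. g\<^sub>1 i x)) M\<^sub>1 ult" by (rule embedding_ult[OF M(1) emb1])
    show "K_embedding L (\<prec>) (\<lambda>x. cls (\<lambda>i. g\<^sub>2 i x)) M\<^sub>2 ult" by (rule embedding_ult[OF M(2) emb2])
    fix x y assume x: "x \<in> univ M\<^sub>1" and y: "y \<in> univ M\<^sub>2"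
    have vx: "\<forall>\<^sub>F i in U. g\<^sub>1 i x \<in> univ (N i)" by (rule val[OF M(1) x emb1])
    have vy: "\<forall>\<^sub>F i in U. g\<^sub>2 i y \<in> univ (N i)" by (rule val[OF M(2) y emb2])
    show "\<exists>Y g\<^sub>1 g\<^sub>2. x \<in> Y \<and> y \<in> Y \<and> \<Phi> Y g\<^sub>1 g\<^sub>2 \<and> g\<^sub>1 x = g\<^sub>2 y"
      if eq: "cls (\<lambda>i. g\<^sub>1 i x) = cls (\<lambda>i. g\<^sub>2 i y)"
    proof -
      have "\<forall>\<^sub>F i in U. x \<in> elts i \<and> y \<in> elts i \<and> \<Phi> (elts i) (g\<^sub>1 i) (g\<^sub>2 i) \<and> g\<^sub>1 i x = g\<^sub>2 i y"
        using ev_pair[OF x y] P(5)[OF vx] P(5)[OF vy] unfolding eq by eventually_elim simp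
      then show ?thesis using ev_ex by blast
    qed
    show "cls (\<lambda>i. g\<^sub>1 i x) = cls (\<lambda>i. g\<^sub>2 i y)"
      if eq: "\<And>Y g\<^sub>1 g\<^sub>2. x \<in> Y \<Longrightarrow> y \<in> Y \<Longrightarrow> \<Phi> Y g\<^sub>1 g\<^sub>2 \<Longrightarrow> g\<^sub>1 x = g\<^sub>2 y"
    proof (rule P(3)[OF P(4)[OF vx] P(4)[OF vy]])
      show "\<forall>\<^sub>F i in U. dec (cls (\<lambda>i. g\<^sub>1 i x)) i = dec (cls (\<lambda>i. g\<^sub>2 i y)) i"
        using ev_pair[OF x y] P(5)[OF vx] P(5)[OF vy]
      proof eventually_elim
        case (elim i)
        then have "g\<^sub>1 i x = g\<^sub>2 i y" using eq[of "elts i" "g\<^sub>1 i" "g\<^sub>2 i"] by blast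
        then show ?case using elim(2,3) by simp
      qed
    qed
  qed
qed

section \<open>The four transfer statements\<close>

context
  fixes \<kappa> \<mu> :: "'v rel"
  assumes LS: "LS_bound L K (\<prec>) \<mu>" and sc: "strongly_compact \<kappa>" and \<mu>\<kappa>: "\<mu> <o \<kappa>"
begin

private lemma \<kappa>: "Cinfinite \<kappa>"
proof -
  have "Cinfinite \<mu>" using LS Cinfinite_of_natLeq by (auto simp: LS_bound_def cardinal_def)
  then show ?thesis
    using sc \<mu>\<kappa> cinfinite_mono ordLess_imp_ordLeq unfolding strongly_compact_def cardinal_def by blast
qed

text \<open>The base \<open>B\<^sub>0\<close> is found first, and its universe is then added to the
  parts to be covered in \<open>M\<^sub>1\<close> and \<open>M\<^sub>2\<close>. Coherence makes it a
  strong submodel of both covers.\<close>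

private lemma local_triples:
  assumes M: "M\<^sub>0 \<in> models_on K (card_atLeast \<mu>)" "M\<^sub>1 \<in> models_on K (card_atLeast \<mu>)"
      "M\<^sub>2 \<in> models_on K (card_atLeast \<mu>)" "M\<^sub>0 \<prec> M\<^sub>1" "M\<^sub>0 \<prec> M\<^sub>2"
    and Y: "|Y| <o \<kappa>"
  obtains B\<^sub>0 B\<^sub>1 B\<^sub>2 where "B\<^sub>0 \<in> models_on K (card_atLeastLessThan \<mu> \<kappa>)"
    "B\<^sub>1 \<in> models_on K (card_atLeastLessThan \<mu> \<kappa>)" "B\<^sub>2 \<in> models_on K (card_atLeastLessThan \<mu> \<kappa>)"
    "B\<^sub>0 \<prec> B\<^sub>1" "B\<^sub>0 \<prec> B\<^sub>2" "B\<^sub>0 \<prec> M\<^sub>0" "B\<^sub>1 \<prec> M\<^sub>1" "B\<^sub>2 \<prec> M\<^sub>2"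
    "Y \<inter> univ M\<^sub>0 \<subseteq> univ B\<^sub>0" "Y \<inter> univ M\<^sub>1 \<subseteq> univ B\<^sub>1" "Y \<inter> univ M\<^sub>2 \<subseteq> univ B\<^sub>2"
proof -
  have Y': "|Y \<inter> X| <o \<kappa>" for X
    using Y card_of_mono1[of "Y \<inter> X" Y] ordLeq_ordLess_trans by blast
  obtain B\<^sub>0 where B\<^sub>0: "B\<^sub>0 \<in> models_on K (card_atLeastLessThan \<mu> \<kappa>)" "B\<^sub>0 \<prec> M\<^sub>0" "Y \<inter> univ M\<^sub>0 \<subseteq> univ B\<^sub>0"
    using medium_submodel[OF LS \<kappa> \<mu>\<kappa>, of M\<^sub>0 "Y \<inter> univ M\<^sub>0"] models_on_card_atLeast[OF M(1)] Y' by blast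
  have "|univ B\<^sub>0| <o \<kappa>"
    using B\<^sub>0(1) ordIso_ordLess_trans unfolding models_on_def card_atLeastLessThan_def by blast
  then have Y\<^sub>0: "|Y \<inter> X \<union> univ B\<^sub>0| <o \<kappa>" for X
    using Y' \<kappa> by (intro Un_Cinfinite_bound_strict)
  have extend: "\<exists>B\<in>models_on K (card_atLeastLessThan \<mu> \<kappa>). B \<prec> M \<and> Y \<inter> univ M \<subseteq> univ B \<and> B\<^sub>0 \<prec> B"
    if M: "M \<in> models_on K (card_atLeast \<mu>)" "M\<^sub>0 \<prec> M" for M
  proof -
    have B\<^sub>0M: "B\<^sub>0 \<prec> M" using B\<^sub>0(2) M(2) by (rule prec_trans)
    then have "univ B\<^sub>0 \<subseteq> univ M" using prec_substruct[OF B\<^sub>0M] by (simp add: substruct_def)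
    then have "Y \<inter> univ M \<union> univ B\<^sub>0 \<subseteq> univ M" by blast
    then obtain B where B: "B \<in> models_on K (card_atLeastLessThan \<mu> \<kappa>)" "B \<prec> M"
      "Y \<inter> univ M \<union> univ B\<^sub>0 \<subseteq> univ B"
      using medium_submodel[OF LS \<kappa> \<mu>\<kappa> _ _ _ Y\<^sub>0] models_on_card_atLeast[OF M(1)] by blast
    have "B\<^sub>0 \<prec> B" using B(3) by (intro prec_of_subset[OF B\<^sub>0M B(2)]) blast
    then show ?thesis using B by blast
  qed
  show thesis using extend[OF M(2,4)] extend[OF M(3,5)] B\<^sub>0 that by blast
qed

lemma AP_transfer:
  assumes AP: "AP_on L K (\<prec>) (card_atLeastLessThan \<mu> \<kappa>)"
  shows "AP_on L K (\<prec>) (card_atLeast \<mu>)"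
  unfolding AP_on_def
proof (intro ballI impI, elim conjE)
  fix M\<^sub>0 M\<^sub>1 M\<^sub>2
  assume M: "M\<^sub>0 \<in> models_on K (card_atLeast \<mu>)" "M\<^sub>1 \<in> models_on K (card_atLeast \<mu>)"
      "M\<^sub>2 \<in> models_on K (card_atLeast \<mu>)" "M\<^sub>0 \<prec> M\<^sub>1" "M\<^sub>0 \<prec> M\<^sub>2"
  have K: "M\<^sub>1 \<in> K" "M\<^sub>2 \<in> K" and sub: "univ M\<^sub>0 \<subseteq> univ M\<^sub>1" "univ M\<^sub>0 \<subseteq> univ M\<^sub>2"
    using M(4,5) prec_in prec_substruct by (auto simp: substruct_def)
  let ?\<Phi> = "\<lambda>Y g\<^sub>1 g\<^sub>2. \<forall>x\<in>Y \<inter> univ M\<^sub>0. g\<^sub>1 x = (g\<^sub>2 x :: 'v)"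
  have loc: "\<exists>B\<^sub>1 B\<^sub>2 N g\<^sub>1 g\<^sub>2.
      B\<^sub>1 \<prec> M\<^sub>1 \<and> B\<^sub>2 \<prec> M\<^sub>2 \<and> Y \<inter> univ M\<^sub>1 \<subseteq> univ B\<^sub>1 \<and> Y \<inter> univ M\<^sub>2 \<subseteq> univ B\<^sub>2 \<and> N \<in> K \<and>
      K_embedding L (\<prec>) g\<^sub>1 B\<^sub>1 N \<and> K_embedding L (\<prec>) g\<^sub>2 B\<^sub>2 N \<and> ?\<Phi> Y g\<^sub>1 g\<^sub>2"
    if Y: "|Y| <o \<kappa>" for Y
  proof -
    obtain B\<^sub>0 B\<^sub>1 B\<^sub>2 where B: "B\<^sub>0 \<in> models_on K (card_atLeastLessThan \<mu> \<kappa>)"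
      "B\<^sub>1 \<in> models_on K (card_atLeastLessThan \<mu> \<kappa>)" "B\<^sub>2 \<in> models_on K (card_atLeastLessThan \<mu> \<kappa>)"
      "B\<^sub>0 \<prec> B\<^sub>1" "B\<^sub>0 \<prec> B\<^sub>2" and B': "B\<^sub>1 \<prec> M\<^sub>1" "B\<^sub>2 \<prec> M\<^sub>2"
      "Y \<inter> univ M\<^sub>0 \<subseteq> univ B\<^sub>0" "Y \<inter> univ M\<^sub>1 \<subseteq> univ B\<^sub>1" "Y \<inter> univ M\<^sub>2 \<subseteq> univ B\<^sub>2"
      using local_triples[OF M Y] by metis
    obtain N g\<^sub>1 g\<^sub>2 where "N \<in> K" "K_embedding L (\<prec>) g\<^sub>1 B\<^sub>1 N" "K_embedding L (\<prec>) g\<^sub>2 B\<^sub>2 N"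
      "\<forall>x\<in>univ B\<^sub>0. g\<^sub>1 x = g\<^sub>2 x"
      using AP[unfolded AP_on_def] B by metis
    moreover from this B'(3) have "?\<Phi> Y g\<^sub>1 g\<^sub>2" by blast
    ultimately show ?thesis using B' by blast
  qed
  show "\<exists>N\<in>K. \<exists>f\<^sub>1 f\<^sub>2. K_embedding L (\<prec>) f\<^sub>1 M\<^sub>1 N \<and> K_embedding L (\<prec>) f\<^sub>2 M\<^sub>2 N \<and>
      (\<forall>x\<in>univ M\<^sub>0. f\<^sub>1 x = f\<^sub>2 x)"
  proof (rule joint_embedding_transfer[OF LS sc \<mu>\<kappa> K, of ?\<Phi>, OF loc])
    fix N f\<^sub>1 f\<^sub>2
    assume N: "N \<in> K" "K_embedding L (\<prec>) f\<^sub>1 M\<^sub>1 N" "K_embedding L (\<prec>) f\<^sub>2 M\<^sub>2 N"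
      and disj: "\<And>x y. x \<in> univ M\<^sub>1 \<Longrightarrow> y \<in> univ M\<^sub>2 \<Longrightarrow> f\<^sub>1 x = f\<^sub>2 y \<Longrightarrow>
        \<exists>Y g\<^sub>1 g\<^sub>2. x \<in> Y \<and> y \<in> Y \<and> ?\<Phi> Y g\<^sub>1 g\<^sub>2 \<and> g\<^sub>1 x = g\<^sub>2 y"
      and eq: "\<And>x y. x \<in> univ M\<^sub>1 \<Longrightarrow> y \<in> univ M\<^sub>2 \<Longrightarrow>
        (\<And>Y g\<^sub>1 g\<^sub>2. x \<in> Y \<Longrightarrow> y \<in> Y \<Longrightarrow> ?\<Phi> Y g\<^sub>1 g\<^sub>2 \<Longrightarrow> g\<^sub>1 x = g\<^sub>2 y) \<Longrightarrow> f\<^sub>1 x = f\<^sub>2 y"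
    have "\<forall>x\<in>univ M\<^sub>0. f\<^sub>1 x = f\<^sub>2 x"
    proof
      fix x assume x: "x \<in> univ M\<^sub>0"
      \<comment> \<open>Both points in \<open>eq\<close> are taken to be \<open>x\<close>;
        \<open>?\<Phi>\<close> supplies the agreement for every part that contains it.\<close>
      show "f\<^sub>1 x = f\<^sub>2 x" by (rule eq) (use x sub in blast)+
    qed
    with N show ?thesis by blast
  qed
qed

lemma DAP_transfer:
  assumes DAP: "DAP_on L K (\<prec>) (card_atLeastLessThan \<mu> \<kappa>)"
  shows "DAP_on L K (\<prec>) (card_atLeast \<mu>)"
  unfolding DAP_on_def
proof (intro ballI impI, elim conjE)
  fix M\<^sub>0 M\<^sub>1 M\<^sub>2
  assume M: "M\<^sub>0 \<in> models_on K (card_atLeast \<mu>)" "M\<^sub>1 \<in> models_on K (card_atLeast \<mu>)"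
      "M\<^sub>2 \<in> models_on K (card_atLeast \<mu>)" "M\<^sub>0 \<prec> M\<^sub>1" "M\<^sub>0 \<prec> M\<^sub>2"
  have K: "M\<^sub>1 \<in> K" "M\<^sub>2 \<in> K" and sub: "univ M\<^sub>0 \<subseteq> univ M\<^sub>1" "univ M\<^sub>0 \<subseteq> univ M\<^sub>2"
    using M(4,5) prec_in prec_substruct by (auto simp: substruct_def)
  \<comment> \<open>The second clause is disjointness over the base in pointwise form. It refers to
    \<open>M\<^sub>0\<close> rather than to \<open>B\<^sub>0\<close>, which varies with the part, so
    it survives the passage to the limit.\<close>
  let ?\<Phi> = "\<lambda>Y g\<^sub>1 g\<^sub>2. (\<forall>x\<in>Y \<inter> univ M\<^sub>0. g\<^sub>1 x = (g\<^sub>2 x :: 'v)) \<and>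
    (\<forall>x\<in>Y \<inter> univ M\<^sub>1. \<forall>y\<in>Y \<inter> univ M\<^sub>2. g\<^sub>1 x = g\<^sub>2 y \<longrightarrow> x \<in> univ M\<^sub>0)"
  have loc: "\<exists>B\<^sub>1 B\<^sub>2 N g\<^sub>1 g\<^sub>2.
      B\<^sub>1 \<prec> M\<^sub>1 \<and> B\<^sub>2 \<prec> M\<^sub>2 \<and> Y \<inter> univ M\<^sub>1 \<subseteq> univ B\<^sub>1 \<and> Y \<inter> univ M\<^sub>2 \<subseteq> univ B\<^sub>2 \<and> N \<in> K \<and>
      K_embedding L (\<prec>) g\<^sub>1 B\<^sub>1 N \<and> K_embedding L (\<prec>) g\<^sub>2 B\<^sub>2 N \<and> ?\<Phi> Y g\<^sub>1 g\<^sub>2"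
    if Y: "|Y| <o \<kappa>" for Y
  proof -
    obtain B\<^sub>0 B\<^sub>1 B\<^sub>2 where B: "B\<^sub>0 \<in> models_on K (card_atLeastLessThan \<mu> \<kappa>)"
      "B\<^sub>1 \<in> models_on K (card_atLeastLessThan \<mu> \<kappa>)" "B\<^sub>2 \<in> models_on K (card_atLeastLessThan \<mu> \<kappa>)"
      "B\<^sub>0 \<prec> B\<^sub>1" "B\<^sub>0 \<prec> B\<^sub>2" and B': "B\<^sub>1 \<prec> M\<^sub>1" "B\<^sub>2 \<prec> M\<^sub>2"
      "Y \<inter> univ M\<^sub>0 \<subseteq> univ B\<^sub>0" "Y \<inter> univ M\<^sub>1 \<subseteq> univ B\<^sub>1" "Y \<inter> univ M\<^sub>2 \<subseteq> univ B\<^sub>2" and B\<^sub>0: "B\<^sub>0 \<prec> M\<^sub>0"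
      using local_triples[OF M Y] by metis
    obtain N g\<^sub>1 g\<^sub>2 where N: "N \<in> K" "K_embedding L (\<prec>) g\<^sub>1 B\<^sub>1 N" "K_embedding L (\<prec>) g\<^sub>2 B\<^sub>2 N"
      "\<forall>x\<in>univ B\<^sub>0. g\<^sub>1 x = g\<^sub>2 x" "g\<^sub>1 ` univ B\<^sub>1 \<inter> g\<^sub>2 ` univ B\<^sub>2 = g\<^sub>1 ` univ B\<^sub>0"
      using DAP[unfolded DAP_on_def] B by metis
    have inj: "inj_on g\<^sub>1 (univ B\<^sub>1)" using N(2) is_iso_inj unfolding K_embedding_def by blast
    have sub: "univ B\<^sub>0 \<subseteq> univ B\<^sub>1" "univ B\<^sub>0 \<subseteq> univ M\<^sub>0"
      using prec_substruct[OF B(4)] prec_substruct[OF B\<^sub>0] by (auto simp: substruct_def)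
    have "x \<in> univ M\<^sub>0" if xy: "x \<in> Y \<inter> univ M\<^sub>1" "y \<in> Y \<inter> univ M\<^sub>2" "g\<^sub>1 x = g\<^sub>2 y" for x y
    proof -
      have x: "x \<in> univ B\<^sub>1" and y: "y \<in> univ B\<^sub>2" using xy B' by blast+
      then have "g\<^sub>1 x \<in> g\<^sub>1 ` univ B\<^sub>1 \<inter> g\<^sub>2 ` univ B\<^sub>2" using xy(3) by (metis IntI imageI)
      then obtain z where z: "z \<in> univ B\<^sub>0" "g\<^sub>1 x = g\<^sub>1 z" unfolding N(5) by blast
      \<comment> \<open>Disjointness only gives some \<open>z\<close> of the base with the same
        image; injectivity of \<open>g\<^sub>1\<close> is needed to place \<open>x\<close> itself in
        the base.\<close>
      then have "x = z" using inj_onD[OF inj] x sub(1) by blast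
      then show ?thesis using z sub(2) by blast
    qed
    moreover have "\<forall>x\<in>Y \<inter> univ M\<^sub>0. g\<^sub>1 x = g\<^sub>2 x" using N(4) B'(3) by blast
    ultimately have "?\<Phi> Y g\<^sub>1 g\<^sub>2" by blast
    then show ?thesis using B' N(1-3) by blast
  qed
  show "\<exists>N\<in>K. \<exists>f\<^sub>1 f\<^sub>2. K_embedding L (\<prec>) f\<^sub>1 M\<^sub>1 N \<and> K_embedding L (\<prec>) f\<^sub>2 M\<^sub>2 N \<and>
      (\<forall>x\<in>univ M\<^sub>0. f\<^sub>1 x = f\<^sub>2 x) \<and> f\<^sub>1 ` univ M\<^sub>1 \<inter> f\<^sub>2 ` univ M\<^sub>2 = f\<^sub>1 ` univ M\<^sub>0"
  proof (rule joint_embedding_transfer[OF LS sc \<mu>\<kappa> K, of ?\<Phi>, OF loc])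
    fix N f\<^sub>1 f\<^sub>2
    assume N: "N \<in> K" "K_embedding L (\<prec>) f\<^sub>1 M\<^sub>1 N" "K_embedding L (\<prec>) f\<^sub>2 M\<^sub>2 N"
      and disj: "\<And>x y. x \<in> univ M\<^sub>1 \<Longrightarrow> y \<in> univ M\<^sub>2 \<Longrightarrow> f\<^sub>1 x = f\<^sub>2 y \<Longrightarrow>
        \<exists>Y g\<^sub>1 g\<^sub>2. x \<in> Y \<and> y \<in> Y \<and> ?\<Phi> Y g\<^sub>1 g\<^sub>2 \<and> g\<^sub>1 x = g\<^sub>2 y"
      and eq: "\<And>x y. x \<in> univ M\<^sub>1 \<Longrightarrow> y \<in> univ M\<^sub>2 \<Longrightarrow>
        (\<And>Y g\<^sub>1 g\<^sub>2. x \<in> Y \<Longrightarrow> y \<in> Y \<Longrightarrow> ?\<Phi> Y g\<^sub>1 g\<^sub>2 \<Longrightarrow> g\<^sub>1 x = g\<^sub>2 y) \<Longrightarrow> f\<^sub>1 x = f\<^sub>2 y"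
    have agree: "\<forall>x\<in>univ M\<^sub>0. f\<^sub>1 x = f\<^sub>2 x"
    proof
      fix x assume x: "x \<in> univ M\<^sub>0"
      show "f\<^sub>1 x = f\<^sub>2 x" by (rule eq) (use x sub in blast)+
    qed
    moreover have "f\<^sub>1 ` univ M\<^sub>1 \<inter> f\<^sub>2 ` univ M\<^sub>2 = f\<^sub>1 ` univ M\<^sub>0"
    proof
      show "f\<^sub>1 ` univ M\<^sub>1 \<inter> f\<^sub>2 ` univ M\<^sub>2 \<subseteq> f\<^sub>1 ` univ M\<^sub>0"
      proof
        fix z assume "z \<in> f\<^sub>1 ` univ M\<^sub>1 \<inter> f\<^sub>2 ` univ M\<^sub>2"
        then obtain x y where xy: "x \<in> univ M\<^sub>1" "y \<in> univ M\<^sub>2" "z = f\<^sub>1 x" "f\<^sub>1 x = f\<^sub>2 y" by auto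
        then have "x \<in> univ M\<^sub>0" using disj[OF xy(1,2,4)] by blast
        then show "z \<in> f\<^sub>1 ` univ M\<^sub>0" using xy(3) by blast
      qed
      show "f\<^sub>1 ` univ M\<^sub>0 \<subseteq> f\<^sub>1 ` univ M\<^sub>1 \<inter> f\<^sub>2 ` univ M\<^sub>2"
      proof
        fix z assume "z \<in> f\<^sub>1 ` univ M\<^sub>0"
        then obtain x where x: "x \<in> univ M\<^sub>0" "z = f\<^sub>1 x" by blast
        then have "z = f\<^sub>2 x" using agree by simp
        then show "z \<in> f\<^sub>1 ` univ M\<^sub>1 \<inter> f\<^sub>2 ` univ M\<^sub>2" using x sub by blast
      qed
    qed
    ultimately show ?thesis using N by blast
  qed
qed

private lemma local_pairs:
  assumes M: "M\<^sub>1 \<in> models_on K (card_atLeast \<mu>)" "M\<^sub>2 \<in> models_on K (card_atLeast \<mu>)"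
    and Y: "|Y| <o \<kappa>"
  obtains B\<^sub>1 B\<^sub>2 where "B\<^sub>1 \<in> models_on K (card_atLeastLessThan \<mu> \<kappa>)"
    "B\<^sub>2 \<in> models_on K (card_atLeastLessThan \<mu> \<kappa>)" "B\<^sub>1 \<prec> M\<^sub>1" "B\<^sub>2 \<prec> M\<^sub>2"
    "Y \<inter> univ M\<^sub>1 \<subseteq> univ B\<^sub>1" "Y \<inter> univ M\<^sub>2 \<subseteq> univ B\<^sub>2"
proof -
  have "|Y \<inter> X| <o \<kappa>" for X
    using Y card_of_mono1[of "Y \<inter> X" Y] ordLeq_ordLess_trans by blast
  then have "\<exists>B\<in>models_on K (card_atLeastLessThan \<mu> \<kappa>). B \<prec> M \<and> Y \<inter> univ M \<subseteq> univ B"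
    if "M \<in> models_on K (card_atLeast \<mu>)" for M
    using medium_submodel[OF LS \<kappa> \<mu>\<kappa>, of M "Y \<inter> univ M"] models_on_card_atLeast[OF that] by blast
  from this[OF M(1)] this[OF M(2)] show thesis using that by blast
qed

lemma JEP_transfer:
  assumes JEP: "JEP_on L K (\<prec>) (card_atLeastLessThan \<mu> \<kappa>)"
  shows "JEP_on L K (\<prec>) (card_atLeast \<mu>)"
  unfolding JEP_on_def
proof (intro ballI)
  fix M\<^sub>1 M\<^sub>2
  assume M: "M\<^sub>1 \<in> models_on K (card_atLeast \<mu>)" "M\<^sub>2 \<in> models_on K (card_atLeast \<mu>)"
  then have K: "M\<^sub>1 \<in> K" "M\<^sub>2 \<in> K" by (auto simp: models_on_def)
  have loc: "\<exists>B\<^sub>1 B\<^sub>2 N g\<^sub>1 g\<^sub>2.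
      B\<^sub>1 \<prec> M\<^sub>1 \<and> B\<^sub>2 \<prec> M\<^sub>2 \<and> Y \<inter> univ M\<^sub>1 \<subseteq> univ B\<^sub>1 \<and> Y \<inter> univ M\<^sub>2 \<subseteq> univ B\<^sub>2 \<and> N \<in> K \<and>
      K_embedding L (\<prec>) g\<^sub>1 B\<^sub>1 N \<and> K_embedding L (\<prec>) g\<^sub>2 B\<^sub>2 N \<and> True"
    if Y: "|Y| <o \<kappa>" for Y
    using local_pairs[OF M Y] JEP unfolding JEP_on_def by metis
  show "\<exists>N\<in>K. \<exists>f\<^sub>1 f\<^sub>2. K_embedding L (\<prec>) f\<^sub>1 M\<^sub>1 N \<and> K_embedding L (\<prec>) f\<^sub>2 M\<^sub>2 N"
    by (rule joint_embedding_transfer[OF LS sc \<mu>\<kappa> K, of "\<lambda>_ _ _. True", OF loc]) blast+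
qed

lemma DJEP_transfer:
  assumes DJEP: "DJEP_on L K (\<prec>) (card_atLeastLessThan \<mu> \<kappa>)"
  shows "DJEP_on L K (\<prec>) (card_atLeast \<mu>)"
  unfolding DJEP_on_def
proof (intro ballI)
  fix M\<^sub>1 M\<^sub>2
  assume M: "M\<^sub>1 \<in> models_on K (card_atLeast \<mu>)" "M\<^sub>2 \<in> models_on K (card_atLeast \<mu>)"
  then have K: "M\<^sub>1 \<in> K" "M\<^sub>2 \<in> K" by (auto simp: models_on_def)
  let ?\<Phi> = "\<lambda>Y g\<^sub>1 g\<^sub>2. \<forall>x\<in>Y \<inter> univ M\<^sub>1. \<forall>y\<in>Y \<inter> univ M\<^sub>2. g\<^sub>1 x \<noteq> (g\<^sub>2 y :: 'v)"
  have loc: "\<exists>B\<^sub>1 B\<^sub>2 N g\<^sub>1 g\<^sub>2.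
      B\<^sub>1 \<prec> M\<^sub>1 \<and> B\<^sub>2 \<prec> M\<^sub>2 \<and> Y \<inter> univ M\<^sub>1 \<subseteq> univ B\<^sub>1 \<and> Y \<inter> univ M\<^sub>2 \<subseteq> univ B\<^sub>2 \<and> N \<in> K \<and>
      K_embedding L (\<prec>) g\<^sub>1 B\<^sub>1 N \<and> K_embedding L (\<prec>) g\<^sub>2 B\<^sub>2 N \<and> ?\<Phi> Y g\<^sub>1 g\<^sub>2"
    if Y: "|Y| <o \<kappa>" for Y
  proof -
    obtain B\<^sub>1 B\<^sub>2 where B: "B\<^sub>1 \<in> models_on K (card_atLeastLessThan \<mu> \<kappa>)"
      "B\<^sub>2 \<in> models_on K (card_atLeastLessThan \<mu> \<kappa>)" and B': "B\<^sub>1 \<prec> M\<^sub>1" "B\<^sub>2 \<prec> M\<^sub>2"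
      "Y \<inter> univ M\<^sub>1 \<subseteq> univ B\<^sub>1" "Y \<inter> univ M\<^sub>2 \<subseteq> univ B\<^sub>2"
      using local_pairs[OF M Y] by metis
    obtain N g\<^sub>1 g\<^sub>2 where N: "N \<in> K" "K_embedding L (\<prec>) g\<^sub>1 B\<^sub>1 N" "K_embedding L (\<prec>) g\<^sub>2 B\<^sub>2 N"
      "g\<^sub>1 ` univ B\<^sub>1 \<inter> g\<^sub>2 ` univ B\<^sub>2 = {}"
      using DJEP[unfolded DJEP_on_def] B by metis
    have "?\<Phi> Y g\<^sub>1 g\<^sub>2" using N(4) B'(3,4) by (auto simp: disjoint_iff image_iff)
    then show ?thesis using B' N(1-3) by blast
  qed
  show "\<exists>N\<in>K. \<exists>f\<^sub>1 f\<^sub>2. K_embedding L (\<prec>) f\<^sub>1 M\<^sub>1 N \<and> K_embedding L (\<prec>) f\<^sub>2 M\<^sub>2 N \<and>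
      f\<^sub>1 ` univ M\<^sub>1 \<inter> f\<^sub>2 ` univ M\<^sub>2 = {}"
  proof (rule joint_embedding_transfer[OF LS sc \<mu>\<kappa> K, of ?\<Phi>, OF loc])
    fix N f\<^sub>1 f\<^sub>2
    assume N: "N \<in> K" "K_embedding L (\<prec>) f\<^sub>1 M\<^sub>1 N" "K_embedding L (\<prec>) f\<^sub>2 M\<^sub>2 N"
      and disj: "\<And>x y. x \<in> univ M\<^sub>1 \<Longrightarrow> y \<in> univ M\<^sub>2 \<Longrightarrow> f\<^sub>1 x = f\<^sub>2 y \<Longrightarrow>
        \<exists>Y g\<^sub>1 g\<^sub>2. x \<in> Y \<and> y \<in> Y \<and> ?\<Phi> Y g\<^sub>1 g\<^sub>2 \<and> g\<^sub>1 x = g\<^sub>2 y"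
      and eq: "\<And>x y. x \<in> univ M\<^sub>1 \<Longrightarrow> y \<in> univ M\<^sub>2 \<Longrightarrow>
        (\<And>Y g\<^sub>1 g\<^sub>2. x \<in> Y \<Longrightarrow> y \<in> Y \<Longrightarrow> ?\<Phi> Y g\<^sub>1 g\<^sub>2 \<Longrightarrow> g\<^sub>1 x = g\<^sub>2 y) \<Longrightarrow> f\<^sub>1 x = f\<^sub>2 y"
    \<comment> \<open>A common value in the limit would already be a common value in some small
      instance, which \<open>?\<Phi>\<close> forbids.\<close>
    have "f\<^sub>1 x \<noteq> f\<^sub>2 y" if "x \<in> univ M\<^sub>1" "y \<in> univ M\<^sub>2" for x y
      using disj[OF that] that by blast
    then have "f\<^sub>1 ` univ M\<^sub>1 \<inter> f\<^sub>2 ` univ M\<^sub>2 = {}" by (auto simp: disjoint_iff image_iff)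
    then show ?thesis using N by blast
  qed
qed

end

end

theorem theorem1p1:
  fixes L :: "'v::zfc vocabulary"
    and K :: "'v struct set"
    and prec :: "'v struct \<Rightarrow> 'v struct \<Rightarrow> bool"
    and \<kappa> \<mu> LS :: "'v rel"
  assumes "strongly_compact \<kappa>"
    and "AEC L K prec"
    and "is_LS_number L K prec LS"
    and "LS <o \<kappa>"
    and "cardinal \<mu>"
    and "LS \<le>o \<mu>"
    and "\<mu> <o \<kappa>"
  shows "(AP_on L K prec (card_atLeastLessThan \<mu> \<kappa>) \<longrightarrow> AP_on L K prec (card_atLeast \<mu>)) \<and>
    (JEP_on L K prec (card_atLeastLessThan \<mu> \<kappa>) \<longrightarrow> JEP_on L K prec (card_atLeast \<mu>)) \<and>
    (DAP_on L K prec (card_atLeastLessThan \<mu> \<kappa>) \<longrightarrow> DAP_on L K prec (card_atLeast \<mu>)) \<and>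
    (DJEP_on L K prec (card_atLeastLessThan \<mu> \<kappa>) \<longrightarrow> DJEP_on L K prec (card_atLeast \<mu>))"
proof -
  interpret AEC L K prec by (rule assms(2))
  have "LS_bound L K prec LS" using assms(3) by (simp add: is_LS_number_def)
  \<comment> \<open>The Lowenheim-Skolem property passes upwards, which lets \<mu> replace the
    Lowenheim-Skolem number throughout.\<close>
  then have "LS_bound L K prec \<mu>" using assms(5,6) by (rule LS_bound_mono)
  note transfer = this assms(1,7)
  show ?thesis
    using AP_transfer[OF transfer] JEP_transfer[OF transfer] DAP_transfer[OF transfer]
      DJEP_transfer[OF transfer] by blast
qed

end
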